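(* Let $p$ be a prime, $G$ the Vilenkin group associated with $p$, and $G^*$ its dual group. A measurable subset $S$ of $G^*$ is a generalized scaling set if and only if $S=\bigcup_{j=1}^{\infty}B^{-j}\Omega$ modulo null sets, for some wavelet set $\Omega\subset G^*$.
   Context: Vilenkin group: for a prime $p$, $G$ is the group of sequences $x=(x_j)_{j\in\mathbb{Z}}$ with $x_j\in\{0,\dots,p-1\}$ and $x_j=0$ for all $j<k(x)$, under coordinatewise addition mod $p$, denoted $\oplus$ (inverse operation $\ominus$); identity $\theta$. A basis of neighbourhoods of $\theta$ is $U_l=\{x\in G: x_j=0 \text{ for } j\le l\}$, $l\in\mathbb{Z}$; $U=U_0$; Haar measure $\mu$ is normalized by $\mu(U)=1$. The dual group $G^*$ consists of sequences $\omega=(\omega_j)_{j\in\mathbb{Z}}$ of the same form, with the same operations, neighbourhoods $U_l^*$, $U^*=U_0^*=\{\omega : \omega_j=0 \text{ for } j\le 0\}$, and Haar measure $\mu^*$ with $\mu^*(U^* )=1$. The pairing is $\chi(x,\omega)=\exp\big(\frac{2\pi i}{p}\sum_{j\in\mathbb{Z}}x_j\omega_{1-j}\big)$. $H=\{x\in G: x_j=0 \text{ for } j>0\}$. $A\in\mathrm{Aut}(G)$, $(Ax)_j=x_{j+1}$; $B\in\mathrm{Aut}(G^* )$, $(B\omega)_j=\omega_{j+1}$. A function $\psi\in L^2(G)$ is a wavelet if $\{p^{j/2}\psi(A^jx\ominus h): j\in\mathbb{Z},h\in H\}$ is an orthonormal basis of $L^2(G)$. A measurable $\Omega\subset G^*$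 is a wavelet set if $\psi=\check{1}_\Omega$ (the inverse Fourier transform of the characteristic function of $\Omega$) is a wavelet in $L^2(G)$. A measurable $S\subset G^*$ is a generalized scaling set if $\mu^*(S)=\frac{1}{p-1}$ and $BS\setminus S$ is a wavelet set. *)

theory Defs
  imports "HOL-Analysis.Analysis" "HOL-Computational_Algebra.Primes"
begin

text \<open>
  The dual group consists of sequences of the same form with the same operations and
  neighbourhoods, so \<open>vilenkin p\<close> serves both as the carrier of \<open>G\<close> and of \<open>G\<^sup>*\<close>.
  Throughout, \<open>M\<close> denotes the Haar measure of \<open>G\<close> and \<open>N\<close> that of \<open>G\<^sup>*\<close>.
\<close>

type_synonym vseq = "int \<Rightarrow> int"

definition vilenkin :: "nat \<Rightarrow> vseq set" where
  "vilenkin p = {x. (\<forall>j. x j \<in> {0..<int p}) \<and> (\<exists>k. \<forall>j<k. x j = 0)}"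

definition vadd :: "nat \<Rightarrow> vseq \<Rightarrow> vseq \<Rightarrow> vseq" where
  "vadd p x y = (\<lambda>j. (x j + y j) mod int p)"

definition vsub :: "nat \<Rightarrow> vseq \<Rightarrow> vseq \<Rightarrow> vseq" where
  "vsub p x y = (\<lambda>j. (x j - y j) mod int p)"

definition nbhd :: "nat \<Rightarrow> int \<Rightarrow> vseq set" where
  "nbhd p l = {x \<in> vilenkin p. \<forall>j\<le>l. x j = 0}"

definition vilenkin_topology :: "nat \<Rightarrow> vseq topology" where
  "vilenkin_topology p =
     topology (\<lambda>V. V \<subseteq> vilenkin p \<and> (\<forall>x\<in>V. \<exists>l. vadd p x ` nbhd p l \<subseteq> V))"

lemma openin_vilenkin_topology:
  "openin (vilenkin_topology p) V \<longleftrightarrow>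
     V \<subseteq> vilenkin p \<and> (\<forall>x\<in>V. \<exists>l. vadd p x ` nbhd p l \<subseteq> V)"
proof -
  have mono: "nbhd p (max l m) \<subseteq> nbhd p l \<inter> nbhd p m" for l m
    by (auto simp: nbhd_def)
  let ?open = "\<lambda>V. V \<subseteq> vilenkin p \<and> (\<forall>x\<in>V. \<exists>l. vadd p x ` nbhd p l \<subseteq> V)"
  have "?open (V \<inter> W)" if V: "?open V" and W: "?open W" for V W
  proof (intro conjI ballI)
    show "V \<inter> W \<subseteq> vilenkin p" using V by blast
    fix x assume x: "x \<in> V \<inter> W"
    obtain l where l: "vadd p x ` nbhd p l \<subseteq> V" using V x by blast
    obtain m where m: "vadd p x ` nbhd p m \<subseteq> W" using W x by blast
    have "vadd p x ` nbhd p (max l m) \<subseteq> V \<inter> W" using mono[of l m] l m by blast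
    then show "\<exists>l. vadd p x ` nbhd p l \<subseteq> V \<inter> W" ..
  qed
  moreover have "?open (\<Union>K)" if K: "\<forall>V\<in>K. ?open V" for K
  proof (intro conjI ballI)
    show "\<Union>K \<subseteq> vilenkin p" using K by blast
    fix x assume "x \<in> \<Union>K"
    then obtain V where V: "V \<in> K" "x \<in> V" by blast
    then obtain l where "vadd p x ` nbhd p l \<subseteq> V" using K by meson
    then have "vadd p x ` nbhd p l \<subseteq> \<Union>K" using V by (meson Union_upper subset_trans)
    then show "\<exists>l. vadd p x ` nbhd p l \<subseteq> \<Union>K" ..
  qed
  ultimately have "istopology ?open" unfolding istopology_def by simp
  then show ?thesis by (simp only: vilenkin_topology_def topology_inverse')
qed

text \<open>
  Normalized Haar measure on the Borel sets. Since \<open>nbhd p 0\<close> has measure 1 and the group is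
  locally compact and second countable, such a measure is automatically Radon, and it is unique.
\<close>

definition normalized_haar :: "nat \<Rightarrow> vseq measure \<Rightarrow> bool" where
  "normalized_haar p M \<longleftrightarrow>
     space M = vilenkin p \<and>
     sets M = sigma_sets (vilenkin p) {V. openin (vilenkin_topology p) V} \<and>
     (\<forall>x\<in>vilenkin p. \<forall>E\<in>sets M. emeasure M (vadd p x ` E) = emeasure M E) \<and>
     emeasure M (nbhd p 0) = 1"

text \<open>
  For \<open>x\<close> and \<open>\<omega>\<close> in \<open>vilenkin p\<close> only finitely many terms of the sum over all integers are
  nonzero; the sum is taken over exactly those.
\<close>

definition pairing :: "nat \<Rightarrow> vseq \<Rightarrow> vseq \<Rightarrow> complex" where
  "pairing p x \<omega> =
     exp (2 * of_real pi * \<i> / of_nat p * of_int (\<Sum>j | x j * \<omega> (1 - j) \<noteq> 0. x j * \<omega> (1 - j)))"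

definition lattice_H :: "nat \<Rightarrow> vseq set" where
  "lattice_H p = {x \<in> vilenkin p. \<forall>j>0. x j = 0}"

text \<open>The same formula gives the automorphism \<open>A\<close> of \<open>G\<close> and the automorphism \<open>B\<close> of \<open>G\<^sup>*\<close>.\<close>

definition dil :: "vseq \<Rightarrow> vseq" where
  "dil x = (\<lambda>j. x (j + 1))"

definition dil_pow :: "int \<Rightarrow> vseq \<Rightarrow> vseq" where
  "dil_pow k = (if 0 \<le> k then dil ^^ nat k else inv dil ^^ nat (- k))"

lemma dil_pow_apply: "dil_pow k x = (\<lambda>j. x (j + k))"
proof -
  have inv: "inv dil = (\<lambda>x j. x (j - 1))"
    by (rule inv_equality) (auto simp: dil_def)
  have "(dil ^^ n) x = (\<lambda>j. x (j + int n))" for n x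
    by (induction n) (auto simp: dil_def algebra_simps)
  moreover have "(inv dil ^^ n) x = (\<lambda>j. x (j - int n))" for n x
    by (induction n) (auto simp: inv algebra_simps)
  ultimately show ?thesis by (simp add: dil_pow_def)
qed

definition L2 :: "'a measure \<Rightarrow> ('a \<Rightarrow> complex) set" where
  "L2 M = {f \<in> borel_measurable M. integrable M (\<lambda>x. (norm (f x))\<^sup>2)}"

definition L2_inner :: "'a measure \<Rightarrow> ('a \<Rightarrow> complex) \<Rightarrow> ('a \<Rightarrow> complex) \<Rightarrow> complex" where
  "L2_inner M f g = (\<integral>x. f x * cnj (g x) \<partial>M)"

definition L2_norm :: "'a measure \<Rightarrow> ('a \<Rightarrow> complex) \<Rightarrow> real" where
  "L2_norm M f = sqrt (\<integral>x. (norm (f x))\<^sup>2 \<partial>M)"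

text \<open>An orthonormal family, indexed by \<open>I\<close>, whose linear span is dense.\<close>

definition orthonormal_basis_L2 :: "'a measure \<Rightarrow> 'i set \<Rightarrow> ('i \<Rightarrow> 'a \<Rightarrow> complex) \<Rightarrow> bool" where
  "orthonormal_basis_L2 M I e \<longleftrightarrow>
     (\<forall>i\<in>I. e i \<in> L2 M) \<and>
     (\<forall>i\<in>I. \<forall>k\<in>I. L2_inner M (e i) (e k) = (if i = k then 1 else 0)) \<and>
     (\<forall>f\<in>L2 M. \<forall>\<epsilon>>0. \<exists>F c. finite F \<and> F \<subseteq> I \<and>
        L2_norm M (\<lambda>x. f x - (\<Sum>i\<in>F. c i * e i x)) < \<epsilon>)"

definition wavelet_system :: "nat \<Rightarrow> (vseq \<Rightarrow> complex) \<Rightarrow> int \<times> vseq \<Rightarrow> vseq \<Rightarrow> complex" where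
  "wavelet_system p \<psi> = (\<lambda>(j, h) x.
     of_real (real p powr (real_of_int j / 2)) * \<psi> (vsub p (dil_pow j x) h))"

definition wavelet :: "nat \<Rightarrow> vseq measure \<Rightarrow> (vseq \<Rightarrow> complex) \<Rightarrow> bool" where
  "wavelet p M \<psi> \<longleftrightarrow>
     \<psi> \<in> L2 M \<and> orthonormal_basis_L2 M (UNIV \<times> lattice_H p) (wavelet_system p \<psi>)"

text \<open>
  The integral formula for the inverse Fourier transform, valid on \<open>L\<^sup>1 \<inter> L\<^sup>2\<close>. It is applied to
  the characteristic function of a set, which lies in \<open>L\<^sup>1\<close> as soon as it lies in \<open>L\<^sup>2\<close>.
\<close>

definition inv_fourier :: "nat \<Rightarrow> vseq measure \<Rightarrow> (vseq \<Rightarrow> complex) \<Rightarrow> vseq \<Rightarrow> complex" where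
  "inv_fourier p N f x = (\<integral>\<omega>. f \<omega> * pairing p x \<omega> \<partial>N)"

definition wavelet_set :: "nat \<Rightarrow> vseq measure \<Rightarrow> vseq measure \<Rightarrow> vseq set \<Rightarrow> bool" where
  "wavelet_set p M N \<Omega> \<longleftrightarrow>
     \<Omega> \<in> sets N \<and> indicator \<Omega> \<in> L2 N \<and> wavelet p M (inv_fourier p N (indicator \<Omega>))"

definition generalized_scaling_set ::
    "nat \<Rightarrow> vseq measure \<Rightarrow> vseq measure \<Rightarrow> vseq set \<Rightarrow> bool" where
  "generalized_scaling_set p M N S \<longleftrightarrow>
     S \<in> sets N \<and> emeasure N S = ennreal (1 / (real p - 1)) \<and> wavelet_set p M N (dil ` S - S)"

end

theory Submission imports Defs begin

text \<open>
  Write \<open>\<psi>\<close> for the inverse Fourier transform of \<open>1\<^sub>\<Omega>\<close>. The function \<open>\<psi> (A\<^sup>j x)\<close> is, up to a positive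
  factor, the transform of the indicator of \<open>B\<^sup>j \<Omega>\<close>. So orthonormality of the wavelet system at the
  lattice point \<open>h = 0\<close> alone gives, by Plancherel, that \<open>\<Omega>\<close> has measure 1 and that its dilates
  \<open>B\<^sup>j \<Omega>\<close> are pairwise disjoint up to null sets.

  If \<open>S = \<Union>\<^sub>j\<^sub>\<ge>\<^sub>1 B\<^sup>-\<^sup>j \<Omega>\<close>, then the measure of \<open>S\<close> is a geometric series and \<open>B S - S = \<Omega>\<close>.
  Conversely, if \<open>\<Omega> = B S - S\<close> has measure 1 and \<open>S\<close> has measure \<open>1 / (p - 1)\<close>, then comparing the
  measures of \<open>B S\<close> and \<open>S\<close> gives \<open>S \<subseteq> B S\<close> almost everywhere, and \<open>S\<close> telescopes into the sets
  \<open>B\<^sup>-\<^sup>j \<Omega>\<close> and the null set \<open>\<Inter>\<^sub>j B\<^sup>-\<^sup>j S\<close>.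

  Plancherel is only needed for indicators of sets \<open>E\<close>, \<open>F\<close> of finite measure. By Fubini and the
  orthogonality of characters, the integral of the product of the two transforms over the compact
  subgroup \<open>U\<^sub>-\<^sub>n\<close> equals the integral over \<open>E\<close> of the mean of \<open>1\<^sub>F\<close> on cosets of \<open>U\<^sub>n\<close>; this
  tends to the measure of \<open>E \<inter> F\<close> because it is eventually constant when \<open>F\<close> is a coset.
\<close>

subsection \<open>Cylinder sets and dilations\<close>

text \<open>For \<open>a\<close> in \<open>vilenkin p\<close> this is the coset of
  \<open>nbhd p n\<close> through \<open>a\<close>. The description by coordinates keeps arithmetic
  mod \<open>p\<close> out of intersections and dilations. The centre may be any integer sequence;
  the set may then be empty.\<close>

definition cyl :: "nat \<Rightarrow> vseq \<Rightarrow> int \<Rightarrow> vseq set" where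
  "cyl p a n = {x \<in> vilenkin p. \<forall>j\<le>n. x j = a j}"

lemma nbhd_eq_cyl: "nbhd p n = cyl p (\<lambda>_. 0) n"
  by (simp add: nbhd_def cyl_def)

lemma vilenkin_mod: "x \<in> vilenkin p \<Longrightarrow> x j mod int p = x j"
  by (auto simp: vilenkin_def)

lemma vilenkin_modI:
  assumes "p > 0" "\<And>j. j < k \<Longrightarrow> f j = 0"
  shows "(\<lambda>j. f j mod int p) \<in> vilenkin p"
  using assms by (auto simp: vilenkin_def intro!: exI[of _ k])

lemma vilenkin_common_zero:
  assumes "x \<in> vilenkin p" "y \<in> vilenkin p"
  obtains k where "\<And>j. j < k \<Longrightarrow> x j = 0" "\<And>j. j < k \<Longrightarrow> y j = 0"
proof -
  obtain k l where "\<forall>j<k. x j = 0" "\<forall>j<l. y j = 0"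
    using assms by (auto simp: vilenkin_def)
  then show ?thesis by (intro that[of "min k l"]) auto
qed

lemma vadd_vilenkin:
  assumes "p > 0" "x \<in> vilenkin p" "y \<in> vilenkin p"
  shows "vadd p x y \<in> vilenkin p"
proof -
  obtain k where "\<And>j. j < k \<Longrightarrow> x j = 0" "\<And>j. j < k \<Longrightarrow> y j = 0"
    using vilenkin_common_zero[OF assms(2,3)] by blast
  then show ?thesis
    unfolding vadd_def by (intro vilenkin_modI[OF assms(1), of k]) simp
qed

lemma vsub_vilenkin:
  assumes "p > 0" "x \<in> vilenkin p" "y \<in> vilenkin p"
  shows "vsub p x y \<in> vilenkin p"
proof -
  obtain k where "\<And>j. j < k \<Longrightarrow> x j = 0" "\<And>j. j < k \<Longrightarrow> y j = 0"
    using vilenkin_common_zero[OF assms(2,3)] by blast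
  then show ?thesis
    unfolding vsub_def by (intro vilenkin_modI[OF assms(1), of k]) simp
qed

lemma vadd_vsub: "y \<in> vilenkin p \<Longrightarrow> vadd p x (vsub p y x) = y"
  by (auto simp: vadd_def vsub_def mod_simps vilenkin_mod)

lemma vadd_nbhd:
  assumes "p > 0" "a \<in> vilenkin p"
  shows "vadd p a ` nbhd p n = cyl p a n"
proof (intro equalityI subsetI)
  fix y assume "y \<in> vadd p a ` nbhd p n"
  then obtain x where x: "x \<in> vilenkin p" "\<forall>j\<le>n. x j = 0" and y: "y = vadd p a x"
    by (auto simp: nbhd_def)
  show "y \<in> cyl p a n"
    using x assms vadd_vilenkin[OF assms(1,2) x(1)] by (auto simp: y cyl_def vadd_def vilenkin_mod)
next
  fix y assume "y \<in> cyl p a n"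
  then have y: "y \<in> vilenkin p" "\<forall>j\<le>n. y j = a j" by (auto simp: cyl_def)
  have "vsub p y a \<in> nbhd p n"
    using vsub_vilenkin[OF assms(1) y(1) assms(2)] y by (auto simp: nbhd_def vsub_def)
  then show "y \<in> vadd p a ` nbhd p n"
    using vadd_vsub[OF y(1), of a] by (metis imageI)
qed

section \<open>Cylinders as a countable base and as a generator of the Borel sets\<close>

lemma openin_vilenkin_iff:
  "p > 0 \<Longrightarrow> openin (vilenkin_topology p) V \<longleftrightarrow>
     V \<subseteq> vilenkin p \<and> (\<forall>x\<in>V. \<exists>n. cyl p x n \<subseteq> V)"
  unfolding openin_vilenkin_topology by (metis subsetD vadd_nbhd)

lemma self_mem_cyl: "a \<in> vilenkin p \<Longrightarrow> a \<in> cyl p a n"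
  by (simp add: cyl_def)

lemma cyl_sub: "cyl p a n \<subseteq> vilenkin p"
  by (auto simp: cyl_def)

text \<open>Ultrametric geometry: any common point can be taken as the centre of both cylinders, and
  the finer level decides the intersection.\<close>

lemma cyl_Int_cyl:
  "cyl p a n \<inter> cyl p b m = {} \<or> (\<exists>c\<in>vilenkin p. cyl p a n \<inter> cyl p b m = cyl p c (max n m))"
proof (cases "cyl p a n \<inter> cyl p b m = {}")
  case False
  then obtain c where "c \<in> cyl p a n" "c \<in> cyl p b m" by auto
  then have "c \<in> vilenkin p" "cyl p a n \<inter> cyl p b m = cyl p c (max n m)"
    by (auto simp: cyl_def) (metis le_max_iff_disj)+
  then show ?thesis by blast
qed simp

lemma openin_cyl: "p > 0 \<Longrightarrow> openin (vilenkin_topology p) (cyl p a n)"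
  by (subst openin_vilenkin_iff) (auto simp: cyl_def intro!: exI[of _ n])

text \<open>The centre vanishes below some \<open>k\<close>, so a cylinder is coded by
  \<open>k\<close>, the finite list of digits from \<open>k\<close> to \<open>n\<close>, and
  \<open>n\<close>. Here \<open>w k xs\<close> is the sequence with digits \<open>xs\<close> from
  position \<open>k\<close> on and zeros elsewhere.\<close>

lemma countable_cyls: "countable {cyl p a n | a n. a \<in> vilenkin p}"
proof -
  define w where "w = (\<lambda>(k::int) (xs::int list) j. if k \<le> j \<and> j < k + int (length xs) then xs ! nat (j - k) else 0)"
  have "{cyl p a n | a n. a \<in> vilenkin p} \<subseteq> range (\<lambda>(k, xs, n). cyl p (w k xs) n)"
  proof clarify
    fix a n assume "a \<in> vilenkin p"
    then obtain k where k: "\<forall>j<k. a j = 0" by (auto simp: vilenkin_def)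
    define xs where "xs = map (\<lambda>i. a (k + int i)) [0..<nat (n - k + 1)]"
    have "w k xs j = a j" if "j \<le> n" for j
      using k that by (auto simp: w_def xs_def)
    then have "cyl p a n = cyl p (w k xs) n" by (auto simp: cyl_def)
    then show "cyl p a n \<in> range (\<lambda>(k, xs, n). cyl p (w k xs) n)"
      by (intro image_eqI[of _ _ "(k, xs, n)"]) auto
  qed
  then show ?thesis by (rule countable_subset) auto
qed

text \<open>The empty set is added so that the family is closed under intersection, as the
  uniqueness and Dynkin arguments require.\<close>

abbreviation cyls :: "nat \<Rightarrow> vseq set set" where
  "cyls p \<equiv> insert {} {cyl p a n | a n. a \<in> vilenkin p}"

lemma Int_stable_cyls: "Int_stable (cyls p)"
  unfolding Int_stable_def
proof (intro ballI)
  fix A B assume "A \<in> cyls p" "B \<in> cyls p"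
  then consider "A \<inter> B = {}" | a n b m where "A = cyl p a n" "B = cyl p b m" by auto
  then show "A \<inter> B \<in> cyls p"
  proof cases
    case 2
    then show ?thesis using cyl_Int_cyl[of p a n b m] by blast
  qed simp
qed

text \<open>An open set is the union of the cylinders inside it, and there are only countably many
  of those.\<close>

lemma sigma_sets_vilenkin:
  assumes "p > 0"
  shows "sigma_sets (vilenkin p) {V. openin (vilenkin_topology p) V} = sigma_sets (vilenkin p) (cyls p)"
proof (rule antisym; rule sigma_sets_mono; rule subsetI)
  fix V assume "V \<in> {V. openin (vilenkin_topology p) V}"
  then have V: "V \<subseteq> vilenkin p" "\<forall>x\<in>V. \<exists>n. cyl p x n \<subseteq> V"
    using assms by (auto simp: openin_vilenkin_iff)
  define C where "C = {K \<in> {cyl p a n | a n. a \<in> vilenkin p}. K \<subseteq> V}"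
  have "countable C" unfolding C_def by (rule countable_subset[OF _ countable_cyls]) auto
  moreover have "C \<subseteq> sigma_sets (vilenkin p) (cyls p)" by (auto simp: C_def)
  ultimately have "\<Union>C \<in> sigma_sets (vilenkin p) (cyls p)"
    using sigma_sets_UNION[of C] by blast
  moreover have "\<Union>C = V"
  proof
    show "V \<subseteq> \<Union>C"
    proof
      fix x assume x: "x \<in> V"
      then obtain n where "cyl p x n \<subseteq> V" using V by blast
      moreover have "x \<in> vilenkin p" using x V by auto
      ultimately show "x \<in> \<Union>C" by (auto simp: C_def intro: self_mem_cyl)
    qed
  qed (auto simp: C_def)
  ultimately show "V \<in> sigma_sets (vilenkin p) (cyls p)" by simp
next
  fix V assume "V \<in> cyls p"
  then show "V \<in> sigma_sets (vilenkin p) {V. openin (vilenkin_topology p) V}"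
    using openin_cyl[OF assms] by (elim insertE) (auto intro: sigma_sets.Empty)
qed

lemma nbhd_UNION: "(\<Union>i. nbhd p (- int i)) = vilenkin p"
proof
  show "vilenkin p \<subseteq> (\<Union>i. nbhd p (- int i))"
  proof
    fix x assume x: "x \<in> vilenkin p"
    then obtain k where "\<forall>j<k. x j = 0" by (auto simp: vilenkin_def)
    then have "x \<in> nbhd p (- int (nat (1 - k)))" using x by (auto simp: nbhd_def)
    then show "x \<in> (\<Union>i. nbhd p (- int i))" by blast
  qed
qed (auto simp: nbhd_def)

lemma zero_vilenkin: "p > 0 \<Longrightarrow> (\<lambda>_. 0) \<in> vilenkin p"
  by (auto simp: vilenkin_def)

section \<open>Dilations and their action on cylinders\<close>

lemma dil_pow_vilenkin_iff: "dil_pow k x \<in> vilenkin p \<longleftrightarrow> x \<in> vilenkin p"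
proof -
  have "dil_pow k x \<in> vilenkin p" if x: "x \<in> vilenkin p" for k x
  proof -
    obtain l where "\<forall>j<l. x j = 0" using x by (auto simp: vilenkin_def)
    then show ?thesis using x
      by (auto simp: vilenkin_def dil_pow_apply intro!: exI[of _ "l - k"])
  qed
  from this[of x k] this[of "dil_pow k x" "- k"] show ?thesis by (auto simp: dil_pow_apply)
qed

lemma dil_pow_add: "dil_pow k (dil_pow l x) = dil_pow (k + l) x"
  by (auto simp: dil_pow_apply algebra_simps)

lemma dil_pow_0: "dil_pow 0 x = x"
  by (simp add: dil_pow_apply)

lemma dil_pow_1: "dil_pow 1 = dil"
  by (auto simp: dil_pow_apply dil_def)

text \<open>Dilations are bijective on all integer sequences. In this form, membership in an
  iterated dilate reduces to adding exponents.\<close>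

lemma dil_pow_image: "dil_pow k ` E = {x. dil_pow (- k) x \<in> E}"
  by (auto simp: dil_pow_add dil_pow_0 image_iff intro!: bexI[of _ "dil_pow (- k) _"])

lemma dil_pow_cyl: "dil_pow k ` cyl p a n = cyl p (dil_pow k a) (n - k)"
proof -
  have "(\<forall>j\<le>n. x (j - k) = a j) \<longleftrightarrow> (\<forall>j\<le>n - k. x j = a (j + k))" for x :: vseq
  proof safe
    fix j assume "\<forall>j\<le>n. x (j - k) = a j" "j \<le> n - k"
    then show "x j = a (j + k)" by (auto dest: spec[of _ "j + k"])
  next
    fix j assume "\<forall>j\<le>n - k. x j = a (j + k)" "j \<le> n"
    then show "x (j - k) = a j" by (auto dest: spec[of _ "j - k"])
  qed
  then show ?thesis
    by (simp add: dil_pow_image cyl_def dil_pow_vilenkin_iff) (simp add: dil_pow_apply)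
qed

lemma inj_dil_pow: "inj (dil_pow k)"
  by (rule inj_on_inverseI[of _ "dil_pow (- k)"]) (simp add: dil_pow_add dil_pow_0)

subsection \<open>Haar measure on cylinder sets\<close>

text \<open>Instantiated twice, for the Haar measure of \<open>G\<close> and for that of the dual
  group.\<close>

locale haar =
  fixes p :: nat and N :: "vseq measure"
  assumes p_ge_2: "2 \<le> p" and haar: "normalized_haar p N"
begin

lemma p_pos: "p > 0" using p_ge_2 by simp

lemma space_N [simp]: "space N = vilenkin p"
  using haar by (simp add: normalized_haar_def)

lemma sets_N: "sets N = sigma_sets (vilenkin p) (cyls p)"
  using haar sigma_sets_vilenkin[OF p_pos] by (simp add: normalized_haar_def)

lemma cyl_sets: "a \<in> vilenkin p \<Longrightarrow> cyl p a n \<in> sets N"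
  by (auto simp: sets_N)

lemma nbhd_sets: "nbhd p n \<in> sets N"
  using cyl_sets[OF zero_vilenkin[OF p_pos]] by (simp add: nbhd_eq_cyl)

lemma emeasure_translate:
  "a \<in> vilenkin p \<Longrightarrow> E \<in> sets N \<Longrightarrow> emeasure N (vadd p a ` E) = emeasure N E"
  using haar by (simp add: normalized_haar_def)

lemma emeasure_cyl_nbhd: "a \<in> vilenkin p \<Longrightarrow> emeasure N (cyl p a n) = emeasure N (nbhd p n)"
  using emeasure_translate[OF _ nbhd_sets, of a n] vadd_nbhd[OF p_pos] by simp

text \<open>The subgroup splits into \<open>p\<close> cosets of the next one, according to the
  coordinate at \<open>n + 1\<close>, and translation invariance gives them equal measure. The
  sequences \<open>d a\<close> represent the cosets.\<close>

lemma emeasure_nbhd_step: "emeasure N (nbhd p n) = of_nat p * emeasure N (nbhd p (n + 1))"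
proof -
  define d where "d = (\<lambda>a::int. (\<lambda>_. 0)(n + 1 := a))"
  have d: "d a \<in> vilenkin p" if "a \<in> {0..<int p}" for a
    using that by (auto simp: vilenkin_def d_def)
  have "nbhd p n = (\<Union>a\<in>{0..<int p}. cyl p (d a) (n + 1))"
  proof (intro equalityI subsetI)
    fix x assume x: "x \<in> nbhd p n"
    then have "x (n + 1) \<in> {0..<int p}" "x \<in> cyl p (d (x (n + 1))) (n + 1)"
      unfolding nbhd_def cyl_def d_def vilenkin_def by simp_all
    then show "x \<in> (\<Union>a\<in>{0..<int p}. cyl p (d a) (n + 1))" by blast
  next
    fix x assume "x \<in> (\<Union>a\<in>{0..<int p}. cyl p (d a) (n + 1))"
    then show "x \<in> nbhd p n" unfolding nbhd_def cyl_def d_def by auto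
  qed
  also have "emeasure N \<dots> = (\<Sum>a\<in>{0..<int p}. emeasure N (cyl p (d a) (n + 1)))"
  proof (rule sum_emeasure[symmetric])
    show "disjoint_family_on (\<lambda>a. cyl p (d a) (n + 1)) {0..<int p}"
      unfolding disjoint_family_on_def cyl_def d_def by fastforce
  qed (use d cyl_sets in auto)
  also have "\<dots> = of_nat p * emeasure N (nbhd p (n + 1))"
    using d by (simp add: emeasure_cyl_nbhd)
  finally show ?thesis .
qed

text \<open>The normalization fixes the value at level 0; the index relation carries it to both
  positive and negative levels.\<close>

lemma emeasure_nbhd: "emeasure N (nbhd p n) = ennreal (real p powi (- n))"
proof (induction n rule: int_induct[of _ 0])
  case base
  then show ?case using haar by (simp add: normalized_haar_def)
next
  case (step1 n)
  have "of_nat p * emeasure N (nbhd p (n + 1)) = ennreal (real p powi (- n))"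
    using emeasure_nbhd_step[of n] step1 by simp
  also have "real p powi (- n) = real p * real p powi (- (n + 1))"
    using p_pos power_int_add[of "real p" 1 "- (n + 1)"] by simp
  also have "ennreal \<dots> = of_nat p * ennreal (real p powi (- (n + 1)))"
    by (simp add: ennreal_mult ennreal_of_nat_eq_real_of_nat)
  finally show ?case
    using p_pos by (simp add: ennreal_mult_cancel_left)
next
  case (step2 n)
  have "emeasure N (nbhd p (n - 1)) = of_nat p * ennreal (real p powi (- n))"
    using emeasure_nbhd_step[of "n - 1"] step2 by simp
  also have "\<dots> = ennreal (real p * real p powi (- n))"
    by (simp add: ennreal_mult ennreal_of_nat_eq_real_of_nat)
  also have "real p * real p powi (- n) = real p powi (- (n - 1))"
    using p_pos by (simp add: power_int_minus power_int_diff field_simps)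
  finally show ?case .
qed

lemma emeasure_cyl: "a \<in> vilenkin p \<Longrightarrow> emeasure N (cyl p a n) = ennreal (real p powi (- n))"
  by (simp add: emeasure_cyl_nbhd emeasure_nbhd)

sublocale sigma_finite_measure N
proof
  show "\<exists>A. countable A \<and> A \<subseteq> sets N \<and> \<Union>A = space N \<and> (\<forall>a\<in>A. emeasure N a \<noteq> \<infinity>)"
    using nbhd_UNION[of p] nbhd_sets
    by (intro exI[of _ "range (\<lambda>i. nbhd p (- int i))"]) (auto simp: emeasure_nbhd)
qed

text \<open>Cylinders form a generating \<pi>-system, and the sets \<open>nbhd p (- int i)\<close>
  exhaust the group with finite measure.\<close>

lemma measure_eqI_cyls:
  fixes A B :: "vseq measure"
  assumes "sets A = sets N" "sets B = sets N"
    and "\<And>a n. a \<in> vilenkin p \<Longrightarrow> emeasure A (cyl p a n) = emeasure B (cyl p a n)"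
    and "\<And>i. emeasure A (nbhd p (- int i)) \<noteq> \<infinity>"
  shows "A = B"
proof (rule measure_eqI_generator_eq[OF Int_stable_cyls, where A = "\<lambda>i. nbhd p (- int i)"])
  show "cyls p \<subseteq> Pow (vilenkin p)" using cyl_sub by auto
  show "range (\<lambda>i. nbhd p (- int i)) \<subseteq> cyls p"
    using zero_vilenkin[OF p_pos] by (auto simp: nbhd_eq_cyl)
qed (use assms nbhd_UNION in \<open>auto simp: sets_N\<close>)

section \<open>Measurable maps, scaling and translation of Haar measure\<close>

lemma measurable_into_N:
  assumes "f \<in> space K \<rightarrow> vilenkin p"
    and "\<And>a n. a \<in> vilenkin p \<Longrightarrow> f -` cyl p a n \<inter> space K \<in> sets K"
  shows "f \<in> measurable K N"
proof (rule measurable_sigma_sets[OF sets_N])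
  show "cyls p \<subseteq> Pow (vilenkin p)" using cyl_sub by auto
qed (use assms in auto)

text \<open>Fixing one coordinate gives a union of cylinders of that level, and this union is
  countable.\<close>

lemma measurable_coord [measurable]: "(\<lambda>x. x j) \<in> measurable N (count_space UNIV)"
proof (rule measurable_count_space_eq_countable[THEN iffD2, OF countableI_type], intro conjI ballI)
  fix a :: int
  have "{x \<in> vilenkin p. x j = a} = \<Union> {cyl p b j | b. b \<in> vilenkin p \<and> b j = a}"
    by (auto simp: cyl_def)
  also have "\<dots> \<in> sets N"
    by (rule sets.countable_Union)
      (auto intro: cyl_sets countable_subset[OF _ countable_cyls[of p]])
  finally show "(\<lambda>x. x j) -` {a} \<inter> space N \<in> sets N"
    by (simp add: vimage_def Int_def conj_commute)
qed auto

lemma measurable_dil_pow [measurable]: "dil_pow k \<in> measurable N N"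
proof (rule measurable_into_N)
  fix a n assume "a \<in> vilenkin p"
  have "dil_pow k -` cyl p a n \<inter> space N = dil_pow (- k) ` cyl p a n"
    unfolding dil_pow_image by (auto simp: cyl_def dil_pow_vilenkin_iff)
  then show "dil_pow k -` cyl p a n \<inter> space N \<in> sets N"
    using \<open>a \<in> vilenkin p\<close> by (simp add: dil_pow_cyl dil_pow_vilenkin_iff cyl_sets)
qed (auto simp: dil_pow_vilenkin_iff)

lemma dil_pow_image_eq_vimage:
  "E \<in> sets N \<Longrightarrow> dil_pow k ` E = dil_pow (- k) -` E \<inter> space N"
  using sets.sets_into_space[of E N] dil_pow_vilenkin_iff[of "- k" _ p]
  unfolding dil_pow_image space_N by blast

lemma dil_pow_sets [simp, intro]: "E \<in> sets N \<Longrightarrow> dil_pow k ` E \<in> sets N"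
  by (simp add: dil_pow_image_eq_vimage del: space_N)

text \<open>The pushforward under the inverse dilation measures a set by the measure of its dilate.
  Dilating a cylinder lowers its level by \<open>k\<close>, hence the factor; cylinders determine
  the measure.\<close>

lemma distr_dil_pow: "distr N N (dil_pow (- k)) = density N (\<lambda>_. ennreal (real p powi k))"
proof (rule measure_eqI_cyls)
  fix a n assume a: "a \<in> vilenkin p"
  have "emeasure (distr N N (dil_pow (- k))) (cyl p a n) = emeasure N (dil_pow k ` cyl p a n)"
    using a by (simp add: emeasure_distr cyl_sets dil_pow_image_eq_vimage)
  also have "\<dots> = ennreal (real p powi (k - n))"
    using a by (simp add: dil_pow_cyl dil_pow_vilenkin_iff emeasure_cyl)
  also have "\<dots> = ennreal (real p powi k) * ennreal (real p powi (- n))"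
    using p_pos by (simp add: power_int_minus power_int_diff ennreal_mult[symmetric] field_simps)
  finally show *: "emeasure (distr N N (dil_pow (- k))) (cyl p a n) =
      emeasure (density N (\<lambda>_. ennreal (real p powi k))) (cyl p a n)"
    using a by (simp add: emeasure_density_const cyl_sets emeasure_cyl)
next
  fix i
  have "emeasure (distr N N (dil_pow (- k))) (nbhd p (- int i)) = emeasure N (dil_pow k ` nbhd p (- int i))"
    by (simp add: emeasure_distr nbhd_sets dil_pow_image_eq_vimage)
  then show "emeasure (distr N N (dil_pow (- k))) (nbhd p (- int i)) \<noteq> \<infinity>"
    using zero_vilenkin[OF p_pos]
    by (simp add: nbhd_eq_cyl dil_pow_cyl dil_pow_vilenkin_iff emeasure_cyl)
qed auto

lemma emeasure_dil_pow:
  assumes "E \<in> sets N"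
  shows "emeasure N (dil_pow k ` E) = ennreal (real p powi k) * emeasure N E"
proof -
  have "emeasure N (dil_pow k ` E) = emeasure (distr N N (dil_pow (- k))) E"
    using assms by (simp add: emeasure_distr dil_pow_image_eq_vimage)
  then show ?thesis using assms by (simp add: distr_dil_pow emeasure_density_const)
qed

lemma integral_dil_pow:
  fixes f :: "vseq \<Rightarrow> complex"
  assumes [measurable]: "f \<in> borel_measurable N"
  shows "(\<integral>x. f (dil_pow k x) \<partial>N) = of_real (real p powi (- k)) * (\<integral>x. f x \<partial>N)"
proof -
  \<comment> \<open>The exponent is written \<open>- (- k)\<close> so that
    \<open>distr_dil_pow\<close> applies with \<open>- k\<close> in place of
    \<open>k\<close>.\<close>
  have "(\<integral>x. f (dil_pow k x) \<partial>N) = (\<integral>x. f x \<partial>distr N N (dil_pow (- (- k))))"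
    by (subst integral_distr) auto
  also have "\<dots> = (\<integral>x. (real p powi (- k)) *\<^sub>R f x \<partial>N)"
    by (subst distr_dil_pow, subst integral_density) auto
  finally show ?thesis by (simp add: scaleR_conv_of_real)
qed

lemma measurable_vadd:
  assumes "a \<in> vilenkin p"
  shows "vadd p a \<in> measurable N N"
proof (rule measurable_into_N)
  fix b n assume b: "b \<in> vilenkin p"
  have "(a j + x j) mod int p = b j \<longleftrightarrow> x j = (b j - a j) mod int p"
    if "x \<in> vilenkin p" for x j
  proof
    assume "(a j + x j) mod int p = b j"
    then have "(b j - a j) mod int p = x j mod int p" by (metis add_diff_cancel_left' mod_diff_left_eq)
    then show "x j = (b j - a j) mod int p" using that by (simp add: vilenkin_mod)
  qed (use b in \<open>simp add: mod_simps vilenkin_mod\<close>)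
  then have "vadd p a -` cyl p b n \<inter> space N = cyl p (vsub p b a) n"
    using vadd_vilenkin[OF p_pos assms] unfolding cyl_def by (auto simp: vadd_def vsub_def)
  then show "vadd p a -` cyl p b n \<inter> space N \<in> sets N"
    using assms b vsub_vilenkin[OF p_pos] by (simp add: cyl_sets)
qed (use vadd_vilenkin[OF p_pos assms] in auto)

text \<open>Invariance is given for images of sets; integrals need it for preimages. Since
  translation is onto, each set is the image of its preimage.\<close>

lemma distr_vadd:
  assumes "a \<in> vilenkin p"
  shows "distr N N (vadd p a) = N"
proof (rule measure_eqI)
  fix E assume "E \<in> sets (distr N N (vadd p a))"
  then have E: "E \<in> sets N" by simp
  let ?F = "vadd p a -` E \<inter> space N"
  have F: "?F \<in> sets N" using measurable_sets[OF measurable_vadd[OF assms] E] .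
  have "E = vadd p a ` ?F"
  proof (intro equalityI subsetI)
    fix y assume y: "y \<in> E"
    then have y': "y \<in> vilenkin p" using sets.sets_into_space[OF E] by auto
    have "vsub p y a \<in> ?F"
      using y y' vadd_vsub[OF y'] vsub_vilenkin[OF p_pos y' assms] by auto
    then show "y \<in> vadd p a ` ?F" using vadd_vsub[OF y', of a] by (metis imageI)
  qed auto
  then have "emeasure N E = emeasure N ?F" using emeasure_translate[OF assms F] by simp
  then show "emeasure (distr N N (vadd p a)) E = emeasure N E"
    using E measurable_vadd[OF assms] by (simp add: emeasure_distr)
qed simp

lemma integral_vadd:
  fixes f :: "vseq \<Rightarrow> complex"
  assumes "a \<in> vilenkin p" "f \<in> borel_measurable N"
  shows "(\<integral>x. f (vadd p a x) \<partial>N) = (\<integral>x. f x \<partial>N)"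
  using integral_distr[OF measurable_vadd[OF assms(1)], of f] assms by (simp add: distr_vadd)

end

subsection \<open>Orthogonality of characters\<close>

text \<open>The basic character of the integers mod \<open>p\<close>, split off from
  \<open>pairing\<close> so that exponents can be manipulated as integers.\<close>

definition zeta :: "nat \<Rightarrow> int \<Rightarrow> complex" where
  "zeta p s = exp (2 * of_real pi * \<i> / of_nat p * of_int s)"

lemma zeta_add: "zeta p (s + t) = zeta p s * zeta p t"
  by (simp add: zeta_def exp_add[symmetric] algebra_simps add_divide_distrib)

lemma norm_zeta [simp]: "norm (zeta p s) = 1"
  by (simp add: zeta_def norm_exp_eq_Re)

lemma zeta_nonzero [simp]: "zeta p s \<noteq> 0"
  by (simp add: zeta_def)

lemma cnj_zeta: "cnj (zeta p s) = inverse (zeta p s)"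
  using complex_norm_square[of "zeta p s"]
  by (metis inverse_unique norm_zeta of_real_1 one_power2)

lemma zeta_eq_1_iff:
  assumes "p > 0"
  shows "zeta p s = 1 \<longleftrightarrow> int p dvd s"
proof -
  have "zeta p s = 1 \<longleftrightarrow> (\<exists>n::int. 2 * pi / p * s = of_int (2 * n) * pi)"
    unfolding zeta_def exp_eq_1 by simp
  also have "\<dots> \<longleftrightarrow> (\<exists>n::int. of_int s = (of_int (int p * n) :: real))"
    using assms by (simp add: field_simps)
  also have "\<dots> \<longleftrightarrow> int p dvd s" by (simp only: of_int_eq_iff dvd_def)
  finally show ?thesis .
qed

lemma zeta_cong:
  assumes "p > 0" "s mod int p = t mod int p"
  shows "zeta p s = zeta p t"
proof -
  have "zeta p (s - t) = 1"
    using assms by (simp add: zeta_eq_1_iff mod_eq_dvd_iff)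
  then show ?thesis using zeta_add[of p "s - t" t] by simp
qed

text \<open>The summation range in \<open>pairing\<close> depends on both arguments. A fixed window
  in its place lets sums be added termwise and exhibits the pairing as a pointwise limit.\<close>

lemma pairing_eventually_zeta:
  assumes "x \<in> vilenkin p" "\<omega> \<in> vilenkin p"
  shows "\<exists>m. \<forall>n\<ge>m. pairing p x \<omega> = zeta p (\<Sum>j\<in>{-int n..int n}. x j * \<omega> (1 - j))"
proof -
  obtain k where k: "\<And>j. j < k \<Longrightarrow> x j = 0" "\<And>j. j < k \<Longrightarrow> \<omega> j = 0"
    using vilenkin_common_zero[OF assms] by blast
  show ?thesis
  proof (intro exI allI impI)
    \<comment> \<open>A nonzero term forces \<open>j\<close> to lie between \<open>k\<close> and
      \<open>1 - k\<close>, hence the bound on \<open>n\<close>.\<close>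
    fix n assume n: "n \<ge> nat (\<bar>k\<bar> + 1)"
    have "{j. x j * \<omega> (1 - j) \<noteq> 0} \<subseteq> {-int n..int n}"
    proof
      fix j assume "j \<in> {j. x j * \<omega> (1 - j) \<noteq> 0}"
      then have "j \<ge> k" "1 - j \<ge> k" using k by (auto simp: not_less[symmetric])
      then show "j \<in> {-int n..int n}" using n by auto
    qed
    then have "(\<Sum>j | x j * \<omega> (1 - j) \<noteq> 0. x j * \<omega> (1 - j)) = (\<Sum>j\<in>{-int n..int n}. x j * \<omega> (1 - j))"
      by (intro sum.mono_neutral_left) auto
    then show "pairing p x \<omega> = zeta p (\<Sum>j\<in>{-int n..int n}. x j * \<omega> (1 - j))"
      by (simp add: pairing_def zeta_def)
  qed
qed

lemma norm_pairing [simp]: "norm (pairing p x \<omega>) = 1"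
  unfolding pairing_def zeta_def[symmetric] by simp

lemma pairing_cnj_self: "pairing p x \<omega> * cnj (pairing p x \<omega>) = 1"
  using complex_norm_square[of "pairing p x \<omega>"] by simp

text \<open>The dilations of the two groups are adjoint under the pairing: shift the summation index
  by \<open>k\<close>.\<close>

lemma pairing_dil_pow: "pairing p (dil_pow k x) \<omega> = pairing p x (dil_pow k \<omega>)"
proof -
  have "(\<Sum>j | dil_pow k x j * \<omega> (1 - j) \<noteq> 0. dil_pow k x j * \<omega> (1 - j)) =
      (\<Sum>j | x j * dil_pow k \<omega> (1 - j) \<noteq> 0. x j * dil_pow k \<omega> (1 - j))"
    by (rule sum.reindex_bij_witness[of _ "\<lambda>j. j - k" "\<lambda>j. j + k"])
      (auto simp: dil_pow_apply algebra_simps)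
  then show ?thesis by (simp add: pairing_def)
qed

lemma pairing_vadd:
  assumes p: "p > 0" and xy: "x \<in> vilenkin p" "y \<in> vilenkin p" and \<omega>: "\<omega> \<in> vilenkin p"
  shows "pairing p (vadd p x y) \<omega> = pairing p x \<omega> * pairing p y \<omega>"
proof -
  obtain m1 where m1: "\<And>n. n \<ge> m1 \<Longrightarrow> pairing p x \<omega> = zeta p (\<Sum>j\<in>{-int n..int n}. x j * \<omega> (1 - j))"
    using pairing_eventually_zeta[OF xy(1) \<omega>] by blast
  obtain m2 where m2: "\<And>n. n \<ge> m2 \<Longrightarrow> pairing p y \<omega> = zeta p (\<Sum>j\<in>{-int n..int n}. y j * \<omega> (1 - j))"
    using pairing_eventually_zeta[OF xy(2) \<omega>] by blast
  obtain m3 where m3: "\<And>n. n \<ge> m3 \<Longrightarrow> pairing p (vadd p x y) \<omega> =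
      zeta p (\<Sum>j\<in>{-int n..int n}. vadd p x y j * \<omega> (1 - j))"
    using pairing_eventually_zeta[OF vadd_vilenkin[OF p xy] \<omega>] by blast
  define n where "n = max m1 (max m2 m3)"
  let ?J = "{-int n..int n}"
  have "pairing p (vadd p x y) \<omega> = zeta p (\<Sum>j\<in>?J. vadd p x y j * \<omega> (1 - j))"
    by (rule m3) (simp add: n_def)
  also have "\<dots> = zeta p (\<Sum>j\<in>?J. (x j + y j) * \<omega> (1 - j))"
  \<comment> \<open>Coordinates of \<open>vadd p x y\<close> differ from the plain sums by multiples
    of \<open>p\<close>, which \<open>zeta\<close> does not see.\<close>
  proof (rule zeta_cong[OF p])
    have "(\<Sum>j\<in>?J. (vadd p x y j * \<omega> (1 - j)) mod int p) mod int p =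
        (\<Sum>j\<in>?J. ((x j + y j) * \<omega> (1 - j)) mod int p) mod int p"
      by (simp add: vadd_def mod_mult_left_eq)
    then show "(\<Sum>j\<in>?J. vadd p x y j * \<omega> (1 - j)) mod int p =
        (\<Sum>j\<in>?J. (x j + y j) * \<omega> (1 - j)) mod int p"
      by (simp only: mod_sum_eq)
  qed
  also have "\<dots> = pairing p x \<omega> * pairing p y \<omega>"
    by (subst m1[of n], simp add: n_def, subst m2[of n], simp add: n_def)
      (simp add: zeta_add[symmetric] sum.distrib distrib_right)
  finally show ?thesis .
qed

text \<open>Pairing with it reads off a single coordinate of \<omega>; translation by it will
  separate two characters.\<close>

definition unit_seq :: "int \<Rightarrow> vseq" where
  "unit_seq i = (\<lambda>j. if j = i then 1 else 0)"

lemma unit_seq_vilenkin: "2 \<le> p \<Longrightarrow> unit_seq i \<in> vilenkin p"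
  by (auto simp: unit_seq_def vilenkin_def intro!: exI[of _ i])

lemma pairing_unit_seq: "pairing p (unit_seq i) \<omega> = zeta p (\<omega> (1 - i))"
proof -
  have "(\<Sum>j | unit_seq i j * \<omega> (1 - j) \<noteq> 0. unit_seq i j * \<omega> (1 - j)) =
      (\<Sum>j\<in>{i}. unit_seq i j * \<omega> (1 - j))"
    by (rule sum.mono_neutral_left) (auto simp: unit_seq_def)
  then show ?thesis by (simp add: pairing_def zeta_def unit_seq_def)
qed

text \<open>Terms with \<open>j \<le> - n\<close> vanish because of \<open>x\<close>, and the others
  involve only coordinates \<open>1 - j \<le> n\<close> of \<omega>. So \<open>nbhd p n\<close>
  annihilates \<open>nbhd p (- n)\<close>.\<close>

lemma pairing_cong_cyl:
  assumes "x \<in> nbhd p (- n)" "\<And>j. j \<le> n \<Longrightarrow> \<omega> j = \<omega>' j"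
  shows "pairing p x \<omega> = pairing p x \<omega>'"
proof -
  have "x j * \<omega> (1 - j) = x j * \<omega>' (1 - j)" for j
    using assms(1) assms(2)[of "1 - j"] by (cases "j \<le> - n") (auto simp: nbhd_def)
  then show ?thesis by (simp only: pairing_def)
qed

lemma borel_measurable_cnj [measurable]: "cnj \<in> borel_measurable borel"
  by (intro borel_measurable_continuous_onI continuous_intros)

locale haar_pair = M: haar p M + N: haar p N for p M N
begin

sublocale pair_sigma_finite M N ..

text \<open>A pointwise limit of window sums, each depending on finitely many coordinates.\<close>

lemma measurable_pairing [measurable]: "(\<lambda>(x, \<omega>). pairing p x \<omega>) \<in> borel_measurable (M \<Otimes>\<^sub>M N)"
proof (rule borel_measurable_LIMSEQ_metric)
  fix n :: nat
  have [measurable]: "(\<lambda>z. of_int (fst z j) :: complex) \<in> borel_measurable (M \<Otimes>\<^sub>M N)"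
    "(\<lambda>z. of_int (snd z j) :: complex) \<in> borel_measurable (M \<Otimes>\<^sub>M N)" for j
    using measurable_compose[OF measurable_compose[OF measurable_fst M.measurable_coord],
        of of_int borel j N]
      measurable_compose[OF measurable_compose[OF measurable_snd N.measurable_coord],
        of of_int borel j M]
    by auto
  show "(\<lambda>z. zeta p (\<Sum>j\<in>{-int n..int n}. fst z j * snd z (1 - j))) \<in> borel_measurable (M \<Otimes>\<^sub>M N)"
    unfolding zeta_def of_int_sum of_int_mult by measurable
next
  fix z assume "z \<in> space (M \<Otimes>\<^sub>M N)"
  then obtain x \<omega> where z: "z = (x, \<omega>)" "x \<in> vilenkin p" "\<omega> \<in> vilenkin p"
    by (auto simp: space_pair_measure)
  obtain m where "\<forall>n\<ge>m. pairing p x \<omega> = zeta p (\<Sum>j\<in>{-int n..int n}. x j * \<omega> (1 - j))"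
    using pairing_eventually_zeta[OF z(2,3)] by blast
  then show "(\<lambda>n. zeta p (\<Sum>j\<in>{-int n..int n}. fst z j * snd z (1 - j))) \<longlonglongrightarrow> (case z of (x, \<omega>) \<Rightarrow> pairing p x \<omega>)"
    by (intro tendsto_eventually eventually_sequentiallyI[of m]) (simp add: z)
qed

lemma measurable_pairing_left: "\<omega> \<in> vilenkin p \<Longrightarrow> (\<lambda>x. pairing p x \<omega>) \<in> borel_measurable M"
  using measurable_Pair2[OF measurable_pairing, of \<omega>] by simp

lemma measurable_pairing_right: "x \<in> vilenkin p \<Longrightarrow> pairing p x \<in> borel_measurable N"
  using measurable_Pair1[OF measurable_pairing, of x] by simp

text \<open>On one coset of \<open>nbhd p n\<close> the product of characters is 1, and the integral
  is the measure of \<open>nbhd p (- n)\<close>. Otherwise a translation within that subgroup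
  multiplies the integral by a root of unity other than 1, so it vanishes.\<close>

lemma integral_pairing_nbhd:
  assumes \<omega>: "\<omega> \<in> vilenkin p" "\<omega>' \<in> vilenkin p"
  shows "(\<integral>x. indicator (nbhd p (- n)) x * (pairing p x \<omega> * cnj (pairing p x \<omega>')) \<partial>M) =
    (of_real (real p powi n) * indicator (cyl p \<omega> n) \<omega>' :: complex)" (is "?I = _")
proof (cases "\<omega>' \<in> cyl p \<omega> n")
  case True
  then have "?I = (\<integral>x. indicator (nbhd p (- n)) x \<partial>M)"
    using pairing_cong_cyl[of _ p n \<omega> \<omega>']
    by (intro Bochner_Integration.integral_cong)
      (auto simp: cyl_def indicator_def pairing_cnj_self)
  also have "\<dots> = (\<integral>x. complex_of_real (indicator (nbhd p (- n)) x) \<partial>M)"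
    by (intro Bochner_Integration.integral_cong) (auto simp: indicator_def)
  also have "\<dots> = of_real (measure M (nbhd p (- n)))"
    using M.nbhd_sets[of "- n", THEN sets.sets_into_space] by (simp add: Int_absorb2)
  finally show ?thesis using True by (simp add: measure_def M.emeasure_nbhd)
next
  case False
  then obtain i where i: "i \<le> n" "\<omega> i \<noteq> \<omega>' i" using \<omega> by (fastforce simp: cyl_def)
  \<comment> \<open>Since \<open>i \<le> n\<close>, the index \<open>1 - i\<close> exceeds
    \<open>- n\<close>, so \<open>?e\<close> lies in \<open>nbhd p (- n)\<close>; pairing with it
    sees coordinate \<open>i\<close>, where \<omega> and \<omega>' differ.\<close>
  let ?e = "unit_seq (1 - i)"
  let ?z = "zeta p (\<omega> i - \<omega>' i)"
  let ?f = "\<lambda>x. indicator (nbhd p (- n)) x * (pairing p x \<omega> * cnj (pairing p x \<omega>'))"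
  have e: "?e \<in> vilenkin p" by (rule unit_seq_vilenkin[OF M.p_ge_2])
  have [measurable]: "?f \<in> borel_measurable M"
    using \<omega>[THEN measurable_pairing_left] M.nbhd_sets[of "- n"] by measurable
  have shift: "?f (vadd p ?e x) = ?z * ?f x" if x: "x \<in> vilenkin p" for x
  proof -
    have "vadd p ?e x \<in> nbhd p (- n) \<longleftrightarrow> x \<in> nbhd p (- n)"
      using i x vadd_vilenkin[OF M.p_pos e x] by (auto simp: nbhd_def vadd_def unit_seq_def vilenkin_mod)
    moreover have "zeta p (\<omega> i) * inverse (zeta p (\<omega>' i)) = ?z"
      using zeta_add[of p "\<omega> i - \<omega>' i" "\<omega>' i"] by (auto simp: field_simps)
    ultimately show ?thesis
      using pairing_vadd[OF M.p_pos e x] \<omega>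
      by (auto simp: indicator_def pairing_unit_seq cnj_zeta)
  qed
  have "?I = (\<integral>x. ?f (vadd p ?e x) \<partial>M)"
    by (rule M.integral_vadd[OF e, symmetric]) measurable
  also have "\<dots> = (\<integral>x. ?z * ?f x \<partial>M)"
    by (rule Bochner_Integration.integral_cong) (use shift in auto)
  also have "\<dots> = ?z * ?I" by simp
  finally have "(1 - ?z) * ?I = 0" by (simp add: algebra_simps)
  moreover have "?z \<noteq> 1"
  proof
    assume "?z = 1"
    then have "\<omega> i mod int p = \<omega>' i mod int p"
      by (simp add: zeta_eq_1_iff[OF M.p_pos] mod_eq_dvd_iff)
    then show False using i \<omega> by (simp add: vilenkin_mod)
  qed
  ultimately show ?thesis using False by simp
qed

end

subsection \<open>Convergence of averages over cylinders\<close>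

text \<open>Dominated convergence for the counting measure.\<close>

lemma tendsto_suminf_ennreal_dominated:
  fixes f :: "nat \<Rightarrow> nat \<Rightarrow> ennreal"
  assumes "\<And>i. (\<lambda>n. f n i) \<longlonglongrightarrow> g i" "\<And>n i. f n i \<le> w i" "(\<Sum>i. w i) < \<infinity>"
  shows "(\<lambda>n. \<Sum>i. f n i) \<longlonglongrightarrow> (\<Sum>i. g i)"
  unfolding nn_integral_count_space_nat[symmetric]
  by (rule nn_integral_dominated_convergence[where w = w])
    (use assms in \<open>auto simp: nn_integral_count_space_nat\<close>)

context haar
begin

text \<open>Cylinders at level \<open>n\<close> have measure \<open>p\<^sup>-\<^sup>n\<close>, so the factor \<open>p\<^sup>n\<close> makes the integrand a mean of \<open>1\<^sub>F\<close>.\<close>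

definition avg :: "int \<Rightarrow> vseq set \<Rightarrow> vseq set \<Rightarrow> ennreal" where
  "avg n E F = (\<integral>\<^sup>+\<omega>. indicator E \<omega> * (ennreal (real p powi n) * emeasure N (F \<inter> cyl p \<omega> n)) \<partial>N)"

lemma cyl_sets_any [measurable]: "cyl p \<omega> n \<in> sets N"
proof (cases "cyl p \<omega> n = {}")
  case False
  then obtain b where "b \<in> cyl p \<omega> n" by auto
  then have "b \<in> vilenkin p" "cyl p \<omega> n = cyl p b n" by (auto simp: cyl_def)
  then show ?thesis by (simp add: cyl_sets)
qed simp

text \<open>Pairs in a common coset of \<open>nbhd p n\<close> with second entry in
  \<open>F\<close>. The sections of this set are the intersections
  \<open>F \<inter> cyl p \<omega> n\<close>, which opens the way to Tonelli.\<close>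

lemma same_cyl_sets:
  assumes [measurable]: "F \<in> sets N"
  shows "{z \<in> space (N \<Otimes>\<^sub>M N). snd z \<in> F \<and> (\<forall>j\<le>n. snd z j = fst z j)} \<in> sets (N \<Otimes>\<^sub>M N)"
  by measurable

lemma Pair_vimage_same_cyl:
  assumes "F \<in> sets N" "\<omega> \<in> vilenkin p"
  shows "Pair \<omega> -` {z \<in> space (N \<Otimes>\<^sub>M N). snd z \<in> F \<and> (\<forall>j\<le>n. snd z j = fst z j)} = F \<inter> cyl p \<omega> n"
  using assms sets.sets_into_space[OF assms(1)] by (auto simp: space_pair_measure cyl_def)

lemma measurable_emeasure_Int_cyl [measurable]:
  assumes "F \<in> sets N"
  shows "(\<lambda>\<omega>. emeasure N (F \<inter> cyl p \<omega> n)) \<in> borel_measurable N"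
proof -
  have "(\<lambda>\<omega>. emeasure N (F \<inter> cyl p \<omega> n)) \<in> borel_measurable N \<longleftrightarrow>
      (\<lambda>\<omega>. emeasure N (Pair \<omega> -` {z \<in> space (N \<Otimes>\<^sub>M N). snd z \<in> F \<and> (\<forall>j\<le>n. snd z j = fst z j)}))
        \<in> borel_measurable N"
    by (rule measurable_cong) (simp only: Pair_vimage_same_cyl[OF assms] space_N)
  then show ?thesis using measurable_emeasure_Pair[OF same_cyl_sets[OF assms, of n]] by simp
qed

sublocale self: pair_sigma_finite N N ..

text \<open>Lying in a common coset is a symmetric relation. After exchanging the integrals, the
  first variable runs through a cylinder of measure \<open>p powi (- n)\<close>, which cancels the
  normalizing factor.\<close>

lemma avg_space:
  assumes [measurable]: "F \<in> sets N"
  shows "avg n (vilenkin p) F = emeasure N F"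
proof -
  let ?Q = "{z \<in> space (N \<Otimes>\<^sub>M N). snd z \<in> F \<and> (\<forall>j\<le>n. snd z j = fst z j)}"
  let ?c = "ennreal (real p powi n)"
  note [measurable] = same_cyl_sets[OF assms, of n]
  have "avg n (vilenkin p) F = (\<integral>\<^sup>+\<omega>. (\<integral>\<^sup>+\<omega>'. ?c * indicator ?Q (\<omega>, \<omega>') \<partial>N) \<partial>N)"
    unfolding avg_def
  proof (rule nn_integral_cong)
    fix \<omega> assume "\<omega> \<in> space N"
    then have \<omega>: "\<omega> \<in> vilenkin p" by simp
    have "(\<integral>\<^sup>+\<omega>'. ?c * indicator ?Q (\<omega>, \<omega>') \<partial>N) = (\<integral>\<^sup>+\<omega>'. ?c * indicator (F \<inter> cyl p \<omega> n) \<omega>' \<partial>N)"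
      using \<omega> by (intro nn_integral_cong) (auto simp: indicator_def cyl_def space_pair_measure)
    also have "\<dots> = ?c * emeasure N (F \<inter> cyl p \<omega> n)"
      by (rule nn_integral_cmult_indicator) measurable
    finally show "indicator (vilenkin p) \<omega> * (?c * emeasure N (F \<inter> cyl p \<omega> n)) =
        (\<integral>\<^sup>+\<omega>'. ?c * indicator ?Q (\<omega>, \<omega>') \<partial>N)" using \<omega> by simp
  qed
  also have "\<dots> = (\<integral>\<^sup>+\<omega>'. (\<integral>\<^sup>+\<omega>. ?c * indicator ?Q (\<omega>, \<omega>') \<partial>N) \<partial>N)"
    by (rule self.Fubini'[symmetric]) measurable
  also have "\<dots> = (\<integral>\<^sup>+\<omega>'. indicator F \<omega>' \<partial>N)"
  proof (rule nn_integral_cong)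
    fix \<omega>' assume "\<omega>' \<in> space N"
    then have \<omega>: "\<omega>' \<in> vilenkin p" by simp
    have "(\<integral>\<^sup>+\<omega>. ?c * indicator ?Q (\<omega>, \<omega>') \<partial>N) =
        (\<integral>\<^sup>+\<omega>. (indicator F \<omega>' * ?c) * indicator (cyl p \<omega>' n) \<omega> \<partial>N)"
      using \<omega> by (intro nn_integral_cong) (auto simp: indicator_def cyl_def space_pair_measure)
    also have "\<dots> = indicator F \<omega>' * ?c * emeasure N (cyl p \<omega>' n)"
      by (rule nn_integral_cmult_indicator) measurable
    also have "\<dots> = indicator F \<omega>'"
      using \<omega> p_pos by (simp add: emeasure_cyl mult.assoc ennreal_mult[symmetric] power_int_minus)
    finally show "(\<integral>\<^sup>+\<omega>. ?c * indicator ?Q (\<omega>, \<omega>') \<partial>N) = indicator F \<omega>'" .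
  qed
  finally show ?thesis by simp
qed

text \<open>The bound is uniform in \<open>n\<close>; it dominates the series in the passage to the
  limit below.\<close>

lemma avg_le: "F \<in> sets N \<Longrightarrow> avg n E F \<le> emeasure N F"
  unfolding avg_space[of F n, symmetric] avg_def
  by (intro nn_integral_mono) (auto simp: indicator_def)

lemma avg_UN:
  assumes [measurable]: "E \<in> sets N" "\<And>i::nat. F i \<in> sets N" and "disjoint_family F"
  shows "avg n E (\<Union>i. F i) = (\<Sum>i. avg n E (F i))"
proof -
  have "emeasure N ((\<Union>i. F i) \<inter> cyl p \<omega> n) = (\<Sum>i. emeasure N (F i \<inter> cyl p \<omega> n))" for \<omega>
    using assms(3) by (subst suminf_emeasure) (auto simp: disjoint_family_on_def)
  then show ?thesis
    unfolding avg_def by (simp add: nn_integral_suminf[symmetric] ennreal_suminf_cmult)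
qed

lemma avg_Un:
  assumes [measurable]: "E \<in> sets N" "F \<in> sets N" "F' \<in> sets N" and "F \<inter> F' = {}"
  shows "avg n E (F \<union> F') = avg n E F + avg n E F'"
proof -
  have "emeasure N ((F \<union> F') \<inter> cyl p \<omega> n) = emeasure N (F \<inter> cyl p \<omega> n) + emeasure N (F' \<inter> cyl p \<omega> n)" for \<omega>
    using assms(4) by (subst plus_emeasure) (auto simp: Int_Un_distrib2)
  then show ?thesis
    unfolding avg_def by (simp add: nn_integral_add[symmetric] distrib_left)
qed

text \<open>Once the averaging cosets are at least as fine as the cylinder, each lies inside it or
  misses it, so the mean is exactly its indicator.\<close>

lemma avg_cyl:
  assumes [measurable]: "E \<in> sets N" and "l \<le> n"
  shows "avg n E (cyl p c l) = emeasure N (E \<inter> cyl p c l)"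
proof -
  have "avg n E (cyl p c l) = (\<integral>\<^sup>+\<omega>. indicator (E \<inter> cyl p c l) \<omega> \<partial>N)"
    unfolding avg_def
  proof (rule nn_integral_cong)
    fix \<omega> assume "\<omega> \<in> space N"
    then have \<omega>: "\<omega> \<in> vilenkin p" by simp
    have "cyl p c l \<inter> cyl p \<omega> n = (if \<omega> \<in> cyl p c l then cyl p \<omega> n else {})"
      using \<omega> assms(2) unfolding cyl_def by (auto dest: order_trans)
    then show "indicator E \<omega> * (ennreal (real p powi n) * emeasure N (cyl p c l \<inter> cyl p \<omega> n)) =
        indicator (E \<inter> cyl p c l) \<omega>"
      using \<omega> p_pos
      by (simp add: emeasure_cyl ennreal_mult[symmetric] power_int_minus indicator_def)
  qed
  then show ?thesis by simp
qed

lemma avg_tendsto_UN: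
  assumes E: "E \<in> sets N" and F: "\<And>i::nat. F i \<in> sets N" "disjoint_family F"
    and fin: "emeasure N (\<Union>i. F i) \<noteq> \<infinity>"
    and lim: "\<And>i. (\<lambda>n. avg (int n) E (F i)) \<longlonglongrightarrow> emeasure N (E \<inter> F i)"
  shows "(\<lambda>n. avg (int n) E (\<Union>i. F i)) \<longlonglongrightarrow> emeasure N (E \<inter> (\<Union>i. F i))"
proof -
  have "(\<lambda>n. \<Sum>i. avg (int n) E (F i)) \<longlonglongrightarrow> (\<Sum>i. emeasure N (E \<inter> F i))"
  proof (rule tendsto_suminf_ennreal_dominated[OF lim avg_le[OF F(1)]])
    have "(\<Sum>i. emeasure N (F i)) = emeasure N (\<Union>i. F i)"
      using F by (intro suminf_emeasure) auto
    then show "(\<Sum>i. emeasure N (F i)) < \<infinity>" using fin by (simp add: top.not_eq_extremum)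
  qed
  moreover have "(\<Sum>i. emeasure N (E \<inter> F i)) = emeasure N (\<Union>i. E \<inter> F i)"
    using E F by (intro suminf_emeasure) (auto simp: disjoint_family_on_def)
  ultimately show ?thesis by (simp add: avg_UN[OF E F])
qed

text \<open>Dynkin induction over \<open>F\<close>, starting from cylinders, where the sequence is
  eventually constant. Cutting with \<open>nbhd p m\<close> keeps every measure finite.\<close>

lemma avg_tendsto_bounded:
  assumes E: "E \<in> sets N" and F: "F \<in> sets N"
  shows "(\<lambda>n. avg (int n) E (F \<inter> nbhd p m)) \<longlonglongrightarrow> emeasure N (E \<inter> (F \<inter> nbhd p m))"
proof -
  note Bsets [simp] = nbhd_sets[of m]
  have fin: "emeasure N (X \<inter> nbhd p m) \<noteq> \<infinity>" for X
    using emeasure_mono[of "X \<inter> nbhd p m" "nbhd p m" N] by (auto simp: emeasure_nbhd top_unique)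
  have cyl_lim: "(\<lambda>n. avg (int n) E (cyl p c l)) \<longlonglongrightarrow> emeasure N (E \<inter> cyl p c l)" for c l
    by (rule tendsto_eventually, rule eventually_sequentiallyI[of "nat l"])
      (auto intro: avg_cyl[OF E])
  have "cyls p \<subseteq> Pow (vilenkin p)" using cyl_sub by auto
  moreover have "F \<in> sigma_sets (vilenkin p) (cyls p)" using F by (simp add: sets_N)
  ultimately show ?thesis
  proof (induction rule: sigma_sets_induct_disjoint[OF Int_stable_cyls, consumes 2, case_names basic empty compl union])
    case (basic A)
    have empty: "avg n E {} = 0" for n by (simp add: avg_def)
    from basic consider "A \<inter> nbhd p m = {}" | c l where "A \<inter> nbhd p m = cyl p c l"
      using cyl_Int_cyl[of p _ _ "\<lambda>_. 0" m] by (auto simp: nbhd_eq_cyl) blast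
    then show ?case
      by cases (simp_all add: empty cyl_lim)
  next
    case empty
    show ?case by (simp add: avg_def)
  next
    case (compl A)
    then have A: "A \<in> sets N" by (simp add: sets_N)
    then have sets: "A \<inter> nbhd p m \<in> sets N" "(vilenkin p - A) \<inter> nbhd p m \<in> sets N"
      by (auto simp flip: space_N)
    have split: "nbhd p m = (A \<inter> nbhd p m) \<union> ((vilenkin p - A) \<inter> nbhd p m)"
      by (auto simp: nbhd_def)
    \<comment> \<open>Finiteness allows subtraction, so the limit for the complement comes from
      those for \<open>A\<close> and for the whole of \<open>nbhd p m\<close>.\<close>
    have diff: "avg n E ((vilenkin p - A) \<inter> nbhd p m) = avg n E (nbhd p m) - avg n E (A \<inter> nbhd p m)" for n
    proof -
      have "avg n E (nbhd p m) = avg n E (A \<inter> nbhd p m) + avg n E ((vilenkin p - A) \<inter> nbhd p m)"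
        by (subst split, rule avg_Un[OF E sets]) auto
      moreover have "avg n E (A \<inter> nbhd p m) \<noteq> \<infinity>"
        using avg_le[OF sets(1), of n E] fin[of A] by (auto simp: top_unique)
      ultimately show ?thesis by simp
    qed
    have "emeasure N (E \<inter> nbhd p m) = emeasure N (E \<inter> (A \<inter> nbhd p m)) + emeasure N (E \<inter> ((vilenkin p - A) \<inter> nbhd p m))"
      using E sets by (subst split, subst plus_emeasure) (auto intro!: arg_cong[where f = "emeasure N"])
    then have diff': "emeasure N (E \<inter> ((vilenkin p - A) \<inter> nbhd p m)) =
        emeasure N (E \<inter> nbhd p m) - emeasure N (E \<inter> (A \<inter> nbhd p m))"
      using fin[of "E \<inter> A"] by (simp add: Int_assoc)
    show ?case
      unfolding diff diff'
    proof (rule tendsto_diff_ennreal[OF _ compl(2)])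
      show "(\<lambda>n. avg (int n) E (nbhd p m)) \<longlonglongrightarrow> emeasure N (E \<inter> nbhd p m)"
        by (simp add: nbhd_eq_cyl cyl_lim)
    qed (use fin[of E] fin[of "E \<inter> A"] in \<open>auto simp: Int_assoc\<close>)
  next
    case (union A)
    then have "A i \<in> sets N" for i by (auto simp: sets_N)
    moreover have "disjoint_family (\<lambda>i. A i \<inter> nbhd p m)"
      using union by (auto simp: disjoint_family_on_def)
    ultimately have "(\<lambda>n. avg (int n) E (\<Union>i. A i \<inter> nbhd p m)) \<longlonglongrightarrow> emeasure N (E \<inter> (\<Union>i. A i \<inter> nbhd p m))"
      using union fin[of "\<Union>i. A i"] by (intro avg_tendsto_UN[OF E]) auto
    then show ?case by simp
  qed
qed

text \<open>\<open>F\<close> is cut into countably many disjoint bounded pieces, and its finite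
  measure makes the sum of their measures converge.\<close>

lemma avg_tendsto:
  assumes E: "E \<in> sets N" and F: "F \<in> sets N" "emeasure N F \<noteq> \<infinity>"
  shows "(\<lambda>n. avg (int n) E F) \<longlonglongrightarrow> emeasure N (E \<inter> F)"
proof -
  let ?D = "disjointed (\<lambda>i. nbhd p (- int i))"
  have D: "?D i \<in> sets N" for i
    using nbhd_sets sets.range_disjointed_sets[of "\<lambda>i. nbhd p (- int i)" N] by auto
  have "F = (\<Union>i. F \<inter> ?D i)"
    using sets.sets_into_space[OF F(1)] nbhd_UNION[of p]
    by (simp add: UN_disjointed_eq flip: Int_UN_distrib) auto
  moreover have "(\<lambda>n. avg (int n) E (\<Union>i. F \<inter> ?D i)) \<longlonglongrightarrow> emeasure N (E \<inter> (\<Union>i. F \<inter> ?D i))"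
  proof (rule avg_tendsto_UN[OF E])
    fix i
    have "F \<inter> ?D i = (F \<inter> ?D i) \<inter> nbhd p (- int i)"
      using disjointed_subset[of "\<lambda>i. nbhd p (- int i)" i] by auto
    then show "(\<lambda>n. avg (int n) E (F \<inter> ?D i)) \<longlonglongrightarrow> emeasure N (E \<inter> (F \<inter> ?D i))"
      using avg_tendsto_bounded[OF E, of "F \<inter> ?D i" "- int i"] F(1) D by simp
    show "F \<inter> ?D i \<in> sets N" using F(1) D by simp
  next
    show "disjoint_family (\<lambda>i. F \<inter> ?D i)"
      using disjoint_family_disjointed[of "\<lambda>i. nbhd p (- int i)"] by (auto simp: disjoint_family_on_def)
    show "emeasure N (\<Union>i. F \<inter> ?D i) \<noteq> \<infinity>" using calculation F(2) by simp
  qed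
  ultimately show ?thesis by simp
qed

end

subsection \<open>Plancherel for indicator functions\<close>

context haar_pair
begin

abbreviation ift :: "vseq set \<Rightarrow> vseq \<Rightarrow> complex" where
  "ift E \<equiv> inv_fourier p N (indicator E)"

lemma measurable_ift [measurable]:
  assumes [measurable]: "E \<in> sets N"
  shows "ift E \<in> borel_measurable M"
  unfolding inv_fourier_def by measurable

lemma norm_ift_le:
  assumes "E \<in> sets N" "emeasure N E < \<infinity>" "x \<in> vilenkin p"
  shows "norm (ift E x) \<le> measure N E"
proof -
  have "norm (ift E x) \<le> (\<integral>\<omega>. norm (indicator E \<omega> * pairing p x \<omega>) \<partial>N)"
    unfolding inv_fourier_def by (rule integral_norm_bound)
  also have "\<dots> = (\<integral>\<omega>. indicator E \<omega> \<partial>N)"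
    by (intro Bochner_Integration.integral_cong) (auto simp: norm_mult indicator_def)
  also have "\<dots> = measure N E"
    using assms(1) sets.sets_into_space[OF assms(1)] by (simp add: Int_absorb2)
  finally show ?thesis .
qed

text \<open>A bounded function cut off to a rectangle of finite measure; this justifies both uses of
  Fubini below.\<close>

lemma integrable_rectangle:
  fixes f :: "vseq \<Rightarrow> vseq \<Rightarrow> complex"
  assumes [measurable]: "A \<in> sets M" "E \<in> sets N" "case_prod f \<in> borel_measurable (M \<Otimes>\<^sub>M N)"
    and fin: "emeasure M A < \<infinity>" "emeasure N E < \<infinity>"
    and bound: "\<And>x \<omega>. x \<in> vilenkin p \<Longrightarrow> \<omega> \<in> vilenkin p \<Longrightarrow> norm (f x \<omega>) \<le> C"
  shows "integrable (M \<Otimes>\<^sub>M N) (\<lambda>(x, \<omega>). indicator A x * (indicator E \<omega> * f x \<omega>))"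
proof (rule Bochner_Integration.integrable_bound[where f = "\<lambda>z. C * indicator (A \<times> E) z :: real"])
  have "emeasure (M \<Otimes>\<^sub>M N) (A \<times> E) < \<infinity>"
    using fin by (simp add: N.emeasure_pair_measure_Times ennreal_mult_less_top)
  then show "integrable (M \<Otimes>\<^sub>M N) (\<lambda>z. C * indicator (A \<times> E) z :: real)"
    by (intro integrable_mult_right integrable_real_indicator) auto
  show "AE z in M \<Otimes>\<^sub>M N. norm (case z of (x, \<omega>) \<Rightarrow> indicator A x * (indicator E \<omega> * f x \<omega>))
      \<le> norm (C * indicator (A \<times> E) z)"
  proof (rule AE_I2, clarify)
    fix x \<omega> assume "(x, \<omega>) \<in> space (M \<Otimes>\<^sub>M N)"
    then have "norm (f x \<omega>) \<le> C" by (auto simp: space_pair_measure intro: bound)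
    then show "norm (indicator A x * (indicator E \<omega> * f x \<omega>)) \<le> norm (C * indicator (A \<times> E) (x, \<omega>))"
      by (auto simp: indicator_def norm_mult)
  qed
qed measurable

text \<open>The two transforms are unfolded one at a time. With \<omega> fixed, Fubini and
  orthogonality turn the transform of \<open>F\<close> into a mean of \<open>F\<close> over a coset;
  a second Fubini integrates this over \<open>E\<close>.\<close>

lemma integral_ift_nbhd:
  assumes E [measurable]: "E \<in> sets N" and F [measurable]: "F \<in> sets N"
    and fin: "emeasure N E < \<infinity>" "emeasure N F < \<infinity>"
  shows "(\<integral>x. indicator (nbhd p (- n)) x * (ift E x * cnj (ift F x)) \<partial>M) =
    complex_of_real (enn2real (N.avg n E F))"
proof -
  let ?U = "nbhd p (- n)"
  note [measurable] = M.nbhd_sets[of "- n"]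
  have U: "emeasure M ?U < \<infinity>" by (simp add: M.emeasure_nbhd)
  have inner: "(\<integral>x. indicator ?U x * (pairing p x \<omega> * cnj (ift F x)) \<partial>M) =
      of_real (real p powi n * measure N (F \<inter> cyl p \<omega> n))" if \<omega>: "\<omega> \<in> vilenkin p" for \<omega>
  proof -
    note [measurable] = measurable_pairing_left[OF \<omega>]
    let ?f = "\<lambda>x \<omega>'. indicator ?U x * (indicator F \<omega>' * (pairing p x \<omega> * cnj (pairing p x \<omega>')))"
    have int: "integrable (M \<Otimes>\<^sub>M N) (\<lambda>(x, \<omega>'). ?f x \<omega>')"
      by (rule integrable_rectangle[where C = 1]) (use U fin in \<open>auto simp: norm_mult\<close>)
    have "(\<integral>x. indicator ?U x * (pairing p x \<omega> * cnj (ift F x)) \<partial>M) = (\<integral>x. (\<integral>\<omega>'. ?f x \<omega>' \<partial>N) \<partial>M)"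
    proof (rule Bochner_Integration.integral_cong[OF refl])
      fix x
      have "cnj (ift F x) = (\<integral>\<omega>'. cnj (indicator F \<omega>' * pairing p x \<omega>') \<partial>N)"
        unfolding inv_fourier_def by (rule Bochner_Integration.integral_cnj[symmetric])
      also have "\<dots> = (\<integral>\<omega>'. indicator F \<omega>' * cnj (pairing p x \<omega>') \<partial>N)"
        by (intro Bochner_Integration.integral_cong) (auto simp: indicator_def)
      finally have "indicator ?U x * (pairing p x \<omega> * cnj (ift F x)) =
          (indicator ?U x * pairing p x \<omega>) * (\<integral>\<omega>'. indicator F \<omega>' * cnj (pairing p x \<omega>') \<partial>N)"
        by simp
      also have "\<dots> = (\<integral>\<omega>'. (indicator ?U x * pairing p x \<omega>) * (indicator F \<omega>' * cnj (pairing p x \<omega>')) \<partial>N)"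
        by (rule integral_mult_right_zero[symmetric])
      finally show "indicator ?U x * (pairing p x \<omega> * cnj (ift F x)) = (\<integral>\<omega>'. ?f x \<omega>' \<partial>N)"
        by (simp add: mult_ac)
    qed
    also have "\<dots> = (\<integral>\<omega>'. (\<integral>x. ?f x \<omega>' \<partial>M) \<partial>N)"
      by (rule Fubini_integral[OF int, symmetric])
    also have "\<dots> = (\<integral>\<omega>'. complex_of_real (real p powi n * indicator (F \<inter> cyl p \<omega> n) \<omega>') \<partial>N)"
    proof (rule Bochner_Integration.integral_cong[OF refl])
      fix \<omega>' assume "\<omega>' \<in> space N"
      then have \<omega>': "\<omega>' \<in> vilenkin p" by simp
      have "(\<integral>x. ?f x \<omega>' \<partial>M) =
          indicator F \<omega>' * (\<integral>x. indicator ?U x * (pairing p x \<omega> * cnj (pairing p x \<omega>')) \<partial>M)"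
        by (subst integral_mult_right_zero[symmetric]) (simp add: mult_ac)
      also have "\<dots> = complex_of_real (real p powi n * indicator (F \<inter> cyl p \<omega> n) \<omega>')"
        by (simp add: integral_pairing_nbhd[OF \<omega> \<omega>']) (simp add: indicator_def)
      finally show "(\<integral>x. ?f x \<omega>' \<partial>M) = complex_of_real (real p powi n * indicator (F \<inter> cyl p \<omega> n) \<omega>')" .
    qed
    also have "\<dots> = of_real (real p powi n * measure N (F \<inter> cyl p \<omega> n))"
      using sets.sets_into_space[OF F] by (subst integral_complex_of_real) (simp add: Int_absorb2 Int_absorb1 le_infI1)
    finally show ?thesis .
  qed
  \<comment> \<open>Second exchange: the transform of \<open>F\<close> stays folded and is bounded
    by the measure of \<open>F\<close>.\<close>
  let ?g = "\<lambda>x \<omega>. indicator ?U x * (indicator E \<omega> * (pairing p x \<omega> * cnj (ift F x)))"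
  have int: "integrable (M \<Otimes>\<^sub>M N) (\<lambda>(x, \<omega>). ?g x \<omega>)"
    by (rule integrable_rectangle[where C = "measure N F"])
      (use U fin norm_ift_le[OF F] in \<open>auto simp: norm_mult\<close>)
  have "(\<integral>x. indicator ?U x * (ift E x * cnj (ift F x)) \<partial>M) = (\<integral>x. (\<integral>\<omega>. ?g x \<omega> \<partial>N) \<partial>M)"
  proof (rule Bochner_Integration.integral_cong[OF refl])
    fix x
    have "indicator ?U x * (ift E x * cnj (ift F x)) =
        (indicator ?U x * cnj (ift F x)) * (\<integral>\<omega>. indicator E \<omega> * pairing p x \<omega> \<partial>N)"
      by (simp add: inv_fourier_def)
    also have "\<dots> = (\<integral>\<omega>. (indicator ?U x * cnj (ift F x)) * (indicator E \<omega> * pairing p x \<omega>) \<partial>N)"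
      by (rule integral_mult_right_zero[symmetric])
    finally show "indicator ?U x * (ift E x * cnj (ift F x)) = (\<integral>\<omega>. ?g x \<omega> \<partial>N)"
      by (simp add: mult_ac)
  qed
  also have "\<dots> = (\<integral>\<omega>. (\<integral>x. ?g x \<omega> \<partial>M) \<partial>N)"
    by (rule Fubini_integral[OF int, symmetric])
  also have "\<dots> = (\<integral>\<omega>. complex_of_real (indicator E \<omega> * (real p powi n * measure N (F \<inter> cyl p \<omega> n))) \<partial>N)"
  proof (rule Bochner_Integration.integral_cong[OF refl])
    fix \<omega> assume "\<omega> \<in> space N"
    then have \<omega>: "\<omega> \<in> vilenkin p" by simp
    have "(\<integral>x. ?g x \<omega> \<partial>M) = indicator E \<omega> * (\<integral>x. indicator ?U x * (pairing p x \<omega> * cnj (ift F x)) \<partial>M)"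
      by (subst integral_mult_right_zero[symmetric]) (simp add: mult_ac)
    then show "(\<integral>x. ?g x \<omega> \<partial>M) = complex_of_real (indicator E \<omega> * (real p powi n * measure N (F \<inter> cyl p \<omega> n)))"
      by (simp add: inner[OF \<omega>]) (simp add: indicator_def)
  qed
  also have "\<dots> = of_real (\<integral>\<omega>. indicator E \<omega> * (real p powi n * measure N (F \<inter> cyl p \<omega> n)) \<partial>N)"
    by (rule integral_complex_of_real)
  also have "(\<integral>\<omega>. indicator E \<omega> * (real p powi n * measure N (F \<inter> cyl p \<omega> n)) \<partial>N) = enn2real (N.avg n E F)"
  proof (subst integral_eq_nn_integral)
    have meas: "emeasure N (F \<inter> cyl p \<omega> n) = ennreal (measure N (F \<inter> cyl p \<omega> n))" for \<omega>
    proof (rule emeasure_eq_ennreal_measure)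
      have "emeasure N (F \<inter> cyl p \<omega> n) \<le> emeasure N F" by (intro emeasure_mono) auto
      then show "emeasure N (F \<inter> cyl p \<omega> n) \<noteq> top" using fin(2) by (auto simp: top_unique)
    qed
    show "enn2real (\<integral>\<^sup>+\<omega>. ennreal (indicator E \<omega> * (real p powi n * measure N (F \<inter> cyl p \<omega> n))) \<partial>N) =
        enn2real (N.avg n E F)"
      unfolding N.avg_def meas
      by (intro arg_cong[where f = enn2real] nn_integral_cong)
        (auto simp: indicator_def ennreal_mult)
    show "(\<lambda>\<omega>. indicator E \<omega> * (real p powi n * measure N (F \<inter> cyl p \<omega> n))) \<in> borel_measurable N"
      unfolding measure_def by measurable
  qed auto
  finally show ?thesis .
qed

text \<open>Both sides are limits of the integral truncated to \<open>nbhd p (- int n)\<close>: one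
  by dominated convergence, the other by convergence of averages. The assumption \<open>int\<close>
  supplies the dominating function.\<close>

lemma plancherel_indicator:
  assumes E: "E \<in> sets N" "emeasure N E < \<infinity>" and F: "F \<in> sets N" "emeasure N F < \<infinity>"
    and int: "integrable M (\<lambda>x. ift E x * cnj (ift F x))"
  shows "(\<integral>x. ift E x * cnj (ift F x) \<partial>M) = complex_of_real (measure N (E \<inter> F))"
proof (rule LIMSEQ_unique)
  let ?f = "\<lambda>x. ift E x * cnj (ift F x)"
  show "(\<lambda>n. \<integral>x. indicator (nbhd p (- int n)) x * ?f x \<partial>M) \<longlonglongrightarrow> (\<integral>x. ?f x \<partial>M)"
  proof (rule integral_dominated_convergence[where w = "\<lambda>x. norm (?f x)"])
    show "AE x in M. (\<lambda>n. indicator (nbhd p (- int n)) x * ?f x) \<longlonglongrightarrow> ?f x"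
    proof (rule AE_I2)
      fix x assume "x \<in> space M"
      then obtain m where m: "x \<in> nbhd p (- int m)" using nbhd_UNION[of p] by auto
      show "(\<lambda>n. indicator (nbhd p (- int n)) x * ?f x) \<longlonglongrightarrow> ?f x"
        by (rule tendsto_eventually, rule eventually_sequentiallyI[of m])
          (use m in \<open>auto simp: nbhd_def\<close>)
    qed
    show "(\<lambda>x. indicator (nbhd p (- int n)) x * ?f x) \<in> borel_measurable M" for n
      using E F M.nbhd_sets[of "- int n"] by measurable
  qed (use int integrable_norm[OF int] in \<open>auto simp: indicator_def norm_mult dest: borel_measurable_integrable\<close>)
  show "(\<lambda>n. \<integral>x. indicator (nbhd p (- int n)) x * ?f x \<partial>M) \<longlonglongrightarrow> complex_of_real (measure N (E \<inter> F))"
    unfolding integral_ift_nbhd[OF E(1) F(1) E(2) F(2)] measure_def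
  proof (intro tendsto_of_real tendsto_enn2real)
    \<comment> \<open>The limit is put in the form \<open>ennreal\<close> of a real because
      \<open>enn2real\<close> is continuous only at finite values.\<close>
    show "(\<lambda>n. N.avg (int n) E F) \<longlonglongrightarrow> ennreal (enn2real (emeasure N (E \<inter> F)))"
      using N.avg_tendsto[OF E(1) F(1)] F E emeasure_mono[of "E \<inter> F" F N]
      by (subst ennreal_enn2real) (auto simp: less_top[symmetric] top_unique)
  qed auto
qed

end

subsection \<open>Wavelet sets\<close>

lemma integrable_mult_cnj_L2:
  assumes "f \<in> L2 M" "g \<in> L2 M"
  shows "integrable M (\<lambda>x. f x * cnj (g x))"
proof (rule Bochner_Integration.integrable_bound)
  show "integrable M (\<lambda>x. (norm (f x))\<^sup>2 + (norm (g x))\<^sup>2)"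
    using assms by (auto simp: L2_def)
  show "(\<lambda>x. f x * cnj (g x)) \<in> borel_measurable M"
    using assms by (auto simp: L2_def)
  have "\<bar>a * b\<bar> \<le> a\<^sup>2 + b\<^sup>2" for a b :: real
    using sum_squares_bound[of a b] sum_squares_bound[of a "- b"] by (auto simp: abs_if)
  from this[of "norm (f x)" "norm (g x)" for x]
  show "AE x in M. norm (f x * cnj (g x)) \<le> norm ((norm (f x))\<^sup>2 + (norm (g x))\<^sup>2)"
    by (simp add: norm_mult abs_mult)
qed

lemma suminf_geometric_Suc:
  assumes "2 \<le> p"
  shows "(\<Sum>i. ennreal (real p powi (- int (Suc i)))) = ennreal (1 / (real p - 1))"
proof (rule suminf_ennreal_eq)
  have "(\<lambda>i. (1 / real p) * (1 / real p) ^ i) sums ((1 / real p) * (1 / (1 - 1 / real p)))"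
    using assms by (intro sums_mult geometric_sums) auto
  moreover have "(1 / real p) * (1 / real p) ^ i = real p powi (- int (Suc i))" for i
    by (simp only: power_int_minus power_int_of_nat)
      (simp add: power_one_over inverse_eq_divide)
  moreover have "(1 / real p) * (1 / (1 - 1 / real p)) = 1 / (real p - 1)"
    using assms by (simp add: field_simps)
  ultimately show "(\<lambda>i. real p powi (- int (Suc i))) sums (1 / (real p - 1))" by simp
qed simp

lemma UN_atLeast_1: "(\<Union>j\<in>{1::nat..}. f j) = (\<Union>i. f (Suc i))"
  by (metis atLeast_Suc_greaterThan One_nat_def UN_extend_simps(10) greaterThan_0)

section \<open>Measure of a set and its dilates: telescoping and tiling\<close>

context haar
begin

lemma null_dil_pow:
  assumes "E \<in> null_sets N"
  shows "dil_pow k ` E \<in> null_sets N"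
  using assms by (auto simp: null_sets_def emeasure_dil_pow)

lemma sym_diff_dil_pow_Union_null:
  assumes S: "S \<in> sets N" and \<mu>S: "emeasure N S = ennreal (1 / (real p - 1))"
    and \<mu>\<Omega>: "emeasure N (dil_pow 1 ` S - S) = 1"
  shows "sym_diff S (\<Union>i. dil_pow (- int (Suc i)) ` (dil_pow 1 ` S - S)) \<in> null_sets N"
proof -
  let ?T = "\<Union>i. dil_pow (- int (Suc i)) ` (dil_pow 1 ` S - S)"
  have fin: "emeasure N S \<noteq> \<infinity>" using \<mu>S by simp
  \<comment> \<open>Dilation multiplies measure by \<open>p\<close>, and
    \<open>p / (p - 1) = 1 + 1 / (p - 1)\<close>: the excess is just the measure of B S - S.\<close>
  have BS: "emeasure N (dil_pow 1 ` S) = 1 + emeasure N S"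
  proof -
    have "emeasure N (dil_pow 1 ` S) = ennreal (real p * (1 / (real p - 1)))"
      using p_ge_2 by (simp add: emeasure_dil_pow[OF S] \<mu>S ennreal_mult[symmetric])
    also have "real p * (1 / (real p - 1)) = 1 + 1 / (real p - 1)"
      using p_ge_2 by (simp add: field_simps)
    also have "ennreal \<dots> = 1 + emeasure N S"
      using p_ge_2 ennreal_plus[of 1 "1 / (real p - 1)"] by (simp add: \<mu>S)
    finally show ?thesis .
  qed
  have "emeasure N (dil_pow 1 ` S) = emeasure N (dil_pow 1 ` S - S) + emeasure N (dil_pow 1 ` S \<inter> S)"
    using S by (subst plus_emeasure) (auto intro!: arg_cong[where f = "emeasure N"])
  then have "emeasure N (dil_pow 1 ` S \<inter> S) = emeasure N S"
    using BS \<mu>\<Omega> by simp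
  moreover have "emeasure N S = emeasure N (S - dil_pow 1 ` S) + emeasure N (dil_pow 1 ` S \<inter> S)"
    using S by (subst plus_emeasure) (auto intro!: arg_cong[where f = "emeasure N"])
  ultimately have "emeasure N S = emeasure N S + emeasure N (S - dil_pow 1 ` S)"
    by (simp add: add.commute)
  then have null: "S - dil_pow 1 ` S \<in> null_sets N"
    using S fin by (auto simp: null_sets_def)
  \<comment> \<open>Points whose forward orbit enters \<open>S\<close> at some step from a point
    outside \<open>S\<close>.\<close>
  let ?K = "\<Union>i. dil_pow (- int i) ` (S - dil_pow 1 ` S)"
  have K: "?K \<in> null_sets N"
    using null by (intro null_sets_UN null_dil_pow)
  \<comment> \<open>Points whose forward orbit never leaves \<open>S\<close>; the
    \<open>i\<close>-th set has measure \<open>p powi (- i) / (p - 1)\<close>, which tends to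
    0.\<close>
  let ?L = "\<Inter>i. dil_pow (- int i) ` S"
  have L_sets: "?L \<in> sets N" using S by auto
  have L: "?L \<in> null_sets N"
  proof -
    have "emeasure N ?L \<le> ennreal (real p powi (- int i) * (1 / (real p - 1)))" for i
    proof -
      have "emeasure N ?L \<le> emeasure N (dil_pow (- int i) ` S)"
        using S by (intro emeasure_mono) auto
      then show ?thesis
        using p_ge_2 by (simp add: emeasure_dil_pow[OF S] \<mu>S ennreal_mult[symmetric])
    qed
    moreover have "(\<lambda>i. ennreal (real p powi (- int i) * (1 / (real p - 1)))) \<longlonglongrightarrow> ennreal 0"
    proof (intro tendsto_ennrealI tendsto_mult_left_zero)
      have "(\<lambda>i. (1 / real p) ^ i) \<longlonglongrightarrow> 0" using p_ge_2 by (intro LIMSEQ_power_zero) auto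
      then show "(\<lambda>i. real p powi (- int i)) \<longlonglongrightarrow> 0"
        by (simp add: power_int_minus power_one_over inverse_eq_divide)
    qed
    ultimately have "emeasure N ?L \<le> ennreal 0"
      by (intro LIMSEQ_le_const) auto
    then show ?thesis using L_sets by (simp add: null_sets_def)
  qed
  have "sym_diff S ?T \<subseteq> ?K \<union> ?L"
  proof (rule subsetI, rule UnCI)
    fix x assume x: "x \<in> sym_diff S ?T" and "x \<notin> ?L"
    \<comment> \<open>Outside \<open>?K\<close> the predicate \<open>P\<close> is decreasing in
      \<open>i\<close>, and outside \<open>?L\<close> it fails somewhere. So it holds at 0 exactly
      if it drops at some index, and a drop is what membership in \<open>?T\<close> means.\<close>
    define P where "P i \<longleftrightarrow> dil_pow (int i) x \<in> S" for i
    have T: "x \<in> ?T \<longleftrightarrow> (\<exists>i. P i \<and> \<not> P (Suc i))"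
      by (simp add: P_def dil_pow_image dil_pow_add add.commute)
    have S: "x \<in> S \<longleftrightarrow> P 0" by (simp add: P_def dil_pow_0)
    have K: "x \<in> ?K \<longleftrightarrow> (\<exists>i. P i \<and> dil_pow (int i - 1) x \<notin> S)"
      by (simp add: P_def dil_pow_image dil_pow_add)
    obtain m where m: "\<not> P m" using \<open>x \<notin> ?L\<close> by (auto simp: P_def dil_pow_image)
    show "x \<in> ?K"
    proof (rule ccontr)
      assume "x \<notin> ?K"
      then have dec: "P i" if "P (Suc i)" for i
        using that unfolding K by (auto simp: P_def dest!: spec[of _ "Suc i"])
      show False
      proof (cases "P 0")
        case True
        then have "\<not> (\<exists>i. P i \<and> \<not> P (Suc i))" using x S T by blast
        then have "P i" for i using True by (induction i) auto
        then show False using m by simp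
      next
        case False
        then have "\<not> P i" for i using dec by (induction i) auto
        then show False using x S T False by blast
      qed
    qed
  qed
  moreover have "sym_diff S ?T \<in> sets N"
    using S by (intro sets.Un sets.Diff sets.countable_UN image_subsetI) auto
  ultimately show ?thesis
    using null_sets_subset[OF null_sets.Un[OF K L]] by blast
qed

lemma emeasure_eq_if_sym_diff_null:
  assumes "E \<in> sets N" "F \<in> sets N" "sym_diff E F \<in> null_sets N"
  shows "emeasure N E = emeasure N F"
proof (rule emeasure_eq_AE)
  show "AE x in N. x \<in> E \<longleftrightarrow> x \<in> F" using AE_not_in[OF assms(3)] by eventually_elim auto
qed (use assms in auto)

text \<open>Deleting all overlaps from \<Omega> gives a set \<open>W\<close> whose dilates are
  exactly disjoint. For \<open>W\<close> the claims become a geometric series and a set identity,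
  which are then carried over modulo null sets.\<close>

lemma dil_pow_tiling:
  assumes \<Omega>: "\<Omega> \<in> sets N" and \<mu>\<Omega>: "emeasure N \<Omega> = 1"
    and null: "\<And>k. k \<noteq> 0 \<Longrightarrow> \<Omega> \<inter> dil_pow k ` \<Omega> \<in> null_sets N"
    and S: "S \<in> sets N" "sym_diff S (\<Union>i. dil_pow (- int (Suc i)) ` \<Omega>) \<in> null_sets N"
  shows "emeasure N S = ennreal (1 / (real p - 1))"
    and "sym_diff (dil_pow 1 ` S - S) \<Omega> \<in> null_sets N"
proof -
  let ?Z = "\<Union>k\<in>- {0}. \<Omega> \<inter> dil_pow k ` \<Omega>"
  have Z: "?Z \<in> null_sets N" using null by (intro null_sets_UN') auto
  define W where "W = \<Omega> - ?Z"
  have W: "W \<in> sets N" using \<Omega> Z by (auto simp: W_def)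
  have \<mu>W: "emeasure N W = 1"
    using emeasure_Diff_null_set[OF Z \<Omega>] \<mu>\<Omega> by (simp add: W_def)
  have disj: "j = k" if "dil_pow j x \<in> W" "dil_pow k x \<in> W" for j k x
  proof (rule ccontr)
    assume "j \<noteq> k"
    moreover have "dil_pow j x \<in> \<Omega> \<inter> dil_pow (j - k) ` \<Omega>"
      using that by (auto simp: W_def dil_pow_image dil_pow_add)
    ultimately have "dil_pow j x \<in> ?Z" by (intro UN_I[of "j - k"]) auto
    then show False using that by (simp add: W_def)
  qed
  let ?T = "\<Union>i. dil_pow (- int (Suc i)) ` W"
  have T: "?T \<in> sets N" using W by auto
  have "emeasure N ?T = (\<Sum>i. emeasure N (dil_pow (- int (Suc i)) ` W))"
  proof (rule suminf_emeasure[symmetric])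
    show "disjoint_family (\<lambda>i. dil_pow (- int (Suc i)) ` W)"
      unfolding disjoint_family_on_def dil_pow_image by (auto dest: disj)
  qed (use W in auto)
  then have \<mu>T: "emeasure N ?T = ennreal (1 / (real p - 1))"
    using suminf_geometric_Suc[OF p_ge_2] by (simp add: emeasure_dil_pow[OF W] \<mu>W del: of_nat_Suc)
  \<comment> \<open>Replacing \<Omega> by \<open>W\<close> changes the union only inside the dilates
    of the overlap set.\<close>
  let ?D = "sym_diff S (\<Union>i. dil_pow (- int (Suc i)) ` \<Omega>) \<union> (\<Union>i. dil_pow (- int (Suc i)) ` ?Z)"
  have D: "?D \<in> null_sets N" using S(2) Z by (intro null_sets.Un[of "sym_diff S _"] null_sets_UN null_dil_pow)
  have ST: "sym_diff S ?T \<subseteq> ?D"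
    unfolding W_def by (auto simp only: Un_iff UN_iff Diff_iff dil_pow_image mem_Collect_eq Int_iff)
  have ST_null: "sym_diff S ?T \<in> null_sets N"
    using S(1) T by (intro null_sets_subset[OF D _ ST]) auto
  then show "emeasure N S = ennreal (1 / (real p - 1))"
    using emeasure_eq_if_sym_diff_null[OF S(1) T] \<mu>T by simp
  \<comment> \<open>Dilated once, the union starts at exponent 0 instead of -1; by disjointness, the
    term at 0 is what remains.\<close>
  have W_iff: "x \<in> W \<longleftrightarrow> x \<in> dil_pow 1 ` ?T \<and> x \<notin> ?T" for x
  proof
    assume "x \<in> W"
    then have "dil_pow 0 x \<in> W" by (simp add: dil_pow_0)
    then show "x \<in> dil_pow 1 ` ?T \<and> x \<notin> ?T"
      using disj[of 0 x "int i + 1" for i] \<open>x \<in> W\<close>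
      by (auto simp: dil_pow_image dil_pow_add intro!: exI[of _ 0])
  next
    assume *: "x \<in> dil_pow 1 ` ?T \<and> x \<notin> ?T"
    then obtain i where "dil_pow (int i) x \<in> W" by (auto simp: dil_pow_image dil_pow_add)
    moreover have "dil_pow (int (Suc k)) x \<notin> W" for k
      using * by (auto simp: dil_pow_image add.commute)
    ultimately show "x \<in> W" by (cases i) (auto simp: dil_pow_0 simp del: of_nat_Suc)
  qed
  let ?D' = "dil_pow 1 ` sym_diff S ?T \<union> sym_diff S ?T \<union> ?Z"
  show "sym_diff (dil_pow 1 ` S - S) \<Omega> \<in> null_sets N"
  proof (rule null_sets_subset)
    show "?D' \<in> null_sets N" using ST_null Z by (intro null_sets.Un[OF null_sets.Un] null_dil_pow)
    show "sym_diff (dil_pow 1 ` S - S) \<Omega> \<subseteq> ?D'"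
    proof
      fix x assume x: "x \<in> sym_diff (dil_pow 1 ` S - S) \<Omega>"
      have "x \<in> \<Omega> \<longleftrightarrow> x \<in> W \<or> x \<in> ?Z" by (auto simp: W_def)
      then show "x \<in> ?D'"
        using x W_iff[of x] unfolding dil_pow_image by blast
    qed
  qed (use S \<Omega> in auto)
qed

end

section \<open>Wavelets and wavelet sets under changes that do not matter\<close>

lemma L2_cong: "(\<And>x. x \<in> space M \<Longrightarrow> f x = g x) \<Longrightarrow> f \<in> L2 M \<longleftrightarrow> g \<in> L2 M"
  unfolding L2_def by (simp cong: measurable_cong Bochner_Integration.integrable_cong)

lemma orthonormal_basis_L2_cong:
  assumes e: "\<And>i x. i \<in> I \<Longrightarrow> x \<in> space M \<Longrightarrow> e i x = e' i x"
    and basis: "orthonormal_basis_L2 M I e"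
  shows "orthonormal_basis_L2 M I e'"
  unfolding orthonormal_basis_L2_def
proof (intro conjI ballI allI impI)
  fix i assume "i \<in> I"
  then show "e' i \<in> L2 M" using basis e L2_cong[of M "e i" "e' i"]
    by (auto simp: orthonormal_basis_L2_def)
next
  fix i k assume "i \<in> I" "k \<in> I"
  moreover from this have "L2_inner M (e i) (e k) = L2_inner M (e' i) (e' k)"
    unfolding L2_inner_def by (intro Bochner_Integration.integral_cong) (auto simp: e)
  ultimately show "L2_inner M (e' i) (e' k) = (if i = k then 1 else 0)"
    using basis by (simp add: orthonormal_basis_L2_def)
next
  fix f and \<epsilon> :: real assume "f \<in> L2 M" "\<epsilon> > 0"
  then obtain F c where F: "finite F" "F \<subseteq> I" "L2_norm M (\<lambda>x. f x - (\<Sum>i\<in>F. c i * e i x)) < \<epsilon>"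
    using basis unfolding orthonormal_basis_L2_def by blast
  moreover have "L2_norm M (\<lambda>x. f x - (\<Sum>i\<in>F. c i * e i x)) = L2_norm M (\<lambda>x. f x - (\<Sum>i\<in>F. c i * e' i x))"
    unfolding L2_norm_def using F(2)
    by (intro arg_cong[where f = sqrt] Bochner_Integration.integral_cong) (auto simp: e subset_iff cong: sum.cong)
  ultimately show "\<exists>F c. finite F \<and> F \<subseteq> I \<and> L2_norm M (\<lambda>x. f x - (\<Sum>i\<in>F. c i * e' i x)) < \<epsilon>"
    by auto
qed

context haar_pair
begin

lemma wavelet_cong:
  assumes eq: "\<And>x. x \<in> vilenkin p \<Longrightarrow> \<psi> x = \<psi>' x" and "wavelet p M \<psi>"
  shows "wavelet p M \<psi>'"
  unfolding wavelet_def
proof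
  show "\<psi>' \<in> L2 M" using assms L2_cong[of M \<psi> \<psi>'] by (simp add: wavelet_def)
  show "orthonormal_basis_L2 M (UNIV \<times> lattice_H p) (wavelet_system p \<psi>')"
  proof (rule orthonormal_basis_L2_cong[where e = "wavelet_system p \<psi>"])
    fix i :: "int \<times> vseq" and x assume "i \<in> UNIV \<times> lattice_H p" "x \<in> space M"
    then show "wavelet_system p \<psi> i x = wavelet_system p \<psi>' i x"
      by (auto simp: wavelet_system_def lattice_H_def dil_pow_vilenkin_iff intro!: eq vsub_vilenkin[OF M.p_pos])
  qed (use assms in \<open>simp add: wavelet_def\<close>)
qed

text \<open>Indicators that agree almost everywhere have equal inverse transforms at every point of
  the group, so the two wavelet systems agree pointwise there.\<close>

lemma wavelet_set_cong:
  assumes \<Omega>: "wavelet_set p M N \<Omega>" and \<Omega>': "\<Omega>' \<in> sets N" and null: "sym_diff \<Omega>' \<Omega> \<in> null_sets N"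
  shows "wavelet_set p M N \<Omega>'"
proof -
  have sets [measurable]: "\<Omega> \<in> sets N" "\<Omega>' \<in> sets N" using \<Omega> \<Omega>' by (auto simp: wavelet_set_def)
  have ind: "AE \<omega> in N. indicator \<Omega> \<omega> = (indicator \<Omega>' \<omega> :: complex)"
    using AE_not_in[OF null] by eventually_elim (auto simp: indicator_def)
  have "integrable N (\<lambda>\<omega>. (norm (indicator \<Omega>' \<omega> :: complex))\<^sup>2) \<longleftrightarrow>
      integrable N (\<lambda>\<omega>. (norm (indicator \<Omega> \<omega> :: complex))\<^sup>2)"
    by (rule integrable_cong_AE) (use ind in \<open>auto\<close>)
  then have "indicator \<Omega>' \<in> L2 N"
    using \<Omega> by (auto simp: wavelet_set_def L2_def)
  moreover have "wavelet p M (ift \<Omega>')"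
  proof (rule wavelet_cong[where \<psi> = "ift \<Omega>"])
    fix x assume "x \<in> vilenkin p"
    note [measurable] = measurable_pairing_right[OF this]
    show "ift \<Omega> x = ift \<Omega>' x"
      unfolding inv_fourier_def by (rule integral_cong_AE) (use ind in auto)
  qed (use \<Omega> in \<open>simp add: wavelet_set_def\<close>)
  ultimately show ?thesis using \<Omega>' by (simp add: wavelet_set_def)
qed

section \<open>Orthogonality relations for the dilates of a wavelet set\<close>

lemma wavelet_system_zero:
  assumes \<Omega>: "\<Omega> \<in> sets N" and x: "x \<in> vilenkin p"
  shows "wavelet_system p (ift \<Omega>) (j, \<lambda>_. 0) x =
    of_real (real p powr (real_of_int j / 2) * real p powi (- j)) * ift (dil_pow j ` \<Omega>) x"
proof -
  note [measurable] = measurable_pairing_right[OF x] N.dil_pow_sets[OF \<Omega>, of j]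
  have "vsub p (dil_pow j x) (\<lambda>_. 0) = dil_pow j x"
    using x by (simp add: vsub_def vilenkin_mod dil_pow_vilenkin_iff)
  \<comment> \<open>Adjointness moves the dilation from \<open>x\<close> to \<omega>, and
    injectivity moves it inside the indicator, so the integrand is a function of
    \<open>dil_pow j \<omega>\<close>.\<close>
  moreover have "ift \<Omega> (dil_pow j x) =
      (\<integral>\<omega>. indicator (dil_pow j ` \<Omega>) (dil_pow j \<omega>) * pairing p x (dil_pow j \<omega>) \<partial>N)"
    unfolding inv_fourier_def
    by (simp add: pairing_dil_pow indicator_def inj_image_mem_iff[OF inj_dil_pow])
  moreover have "\<dots> = of_real (real p powi (- j)) * ift (dil_pow j ` \<Omega>) x"
    unfolding inv_fourier_def by (rule N.integral_dil_pow) measurable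
  ultimately show ?thesis by (simp add: wavelet_system_def)
qed

lemma wavelet_set_finite:
  assumes "wavelet_set p M N \<Omega>"
  shows "emeasure N \<Omega> < \<infinity>"
proof -
  have \<Omega>: "\<Omega> \<in> sets N" and "integrable N (\<lambda>\<omega>. (norm (indicator \<Omega> \<omega> :: complex))\<^sup>2)"
    using assms by (auto simp: wavelet_set_def L2_def)
  moreover have "(norm (indicator \<Omega> \<omega> :: complex))\<^sup>2 = (indicator \<Omega> \<omega> :: real)" for \<omega>
    by (simp add: indicator_def)
  ultimately have "integrable N (indicator \<Omega> :: _ \<Rightarrow> real)" by simp
  then show ?thesis
    using sets.sets_into_space[OF \<Omega>] by (simp add: integrable_indicator_iff Int_absorb2)
qed

text \<open>The system at lattice point 0 consists of multiples of transforms of the dilates, so its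
  Gram matrix is, by Plancherel, that of the measures of intersections.\<close>

lemma wavelet_set_orthogonality:
  assumes "wavelet_set p M N \<Omega>"
  shows "measure N (dil_pow j ` \<Omega> \<inter> dil_pow k ` \<Omega>) = (if j = k then real p powi j else 0)"
proof -
  have \<Omega>: "\<Omega> \<in> sets N" using assms by (simp add: wavelet_set_def)
  \<comment> \<open>This is \<open>p\<close> to the power \<open>- j / 2\<close>: the square-root
    normalization times the Jacobian of the dilation.\<close>
  define c where "c j = real p powr (real_of_int j / 2) * real p powi (- j)" for j
  define e where "e j = wavelet_system p (ift \<Omega>) (j, \<lambda>_. 0)" for j
  let ?E = "\<lambda>j. dil_pow j ` \<Omega>"
  have c: "c j > 0" for j using M.p_pos by (simp add: c_def)
  have e_eq: "e j x = of_real (c j) * ift (?E j) x" if "x \<in> vilenkin p" for j x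
    using wavelet_system_zero[OF \<Omega> that] by (simp add: e_def c_def)
  have "(\<lambda>_. 0) \<in> lattice_H p" using zero_vilenkin[OF M.p_pos] by (simp add: lattice_H_def)
  then have L2: "e j \<in> L2 M" and ortho: "L2_inner M (e j) (e k) = (if j = k then 1 else 0)" for j k
    using assms by (auto simp: e_def wavelet_set_def wavelet_def orthonormal_basis_L2_def)
  have prod_eq: "e j x * cnj (e k x) = of_real (c j * c k) * (ift (?E j) x * cnj (ift (?E k) x))"
    if "x \<in> vilenkin p" for x
    using that by (simp add: e_eq)
  have "integrable M (\<lambda>x. e j x * cnj (e k x))" by (rule integrable_mult_cnj_L2[OF L2 L2])
  then have "integrable M (\<lambda>x. of_real (c j * c k) * (ift (?E j) x * cnj (ift (?E k) x)))"
    by (rule Bochner_Integration.integrable_cong[OF refl, THEN iffD1, rotated]) (simp add: prod_eq)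
  \<comment> \<open>Plancherel requires integrability of the bare product of transforms, so the
    nonzero constant is divided out.\<close>
  then have "integrable M (\<lambda>x. inverse (of_real (c j * c k)) *
      (of_real (c j * c k) * (ift (?E j) x * cnj (ift (?E k) x))))"
    by (rule integrable_mult_right)
  moreover have "inverse (complex_of_real (c j * c k)) * (of_real (c j * c k) * w) = w" for w
    using c[of j] c[of k] by (subst mult.assoc[symmetric], subst left_inverse) auto
  ultimately have int: "integrable M (\<lambda>x. ift (?E j) x * cnj (ift (?E k) x))"
    by (simp only:)
  have fin: "emeasure N (?E i) < \<infinity>" for i
    using wavelet_set_finite[OF assms] by (simp add: N.emeasure_dil_pow[OF \<Omega>] ennreal_mult_less_top)
  have "L2_inner M (e j) (e k) = (\<integral>x. of_real (c j * c k) * (ift (?E j) x * cnj (ift (?E k) x)) \<partial>M)"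
    unfolding L2_inner_def by (rule Bochner_Integration.integral_cong) (simp_all add: prod_eq)
  also have "\<dots> = complex_of_real (c j * c k * measure N (?E j \<inter> ?E k))"
    using plancherel_indicator[OF _ fin _ fin int] \<Omega> by simp
  finally have eq: "c j * c k * measure N (?E j \<inter> ?E k) = (if j = k then 1 else 0)"
    unfolding ortho by (metis of_real_eq_iff of_real_0 of_real_1)
  have "c j * c j * real p powi j = 1"
  proof -
    have "real p powr (real_of_int j / 2) * real p powr (real_of_int j / 2) = real p powi j"
      using M.p_pos by (simp add: powr_add[symmetric] powr_real_of_int')
    then show ?thesis using M.p_pos by (simp add: c_def power_int_minus field_simps)
  qed
  then have "measure N (?E j \<inter> ?E j) = real p powi j" if "j = k"
    using eq c[of j] that by (metis mult_cancel_left mult_eq_0_iff less_irrefl)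
  then show ?thesis using eq c[of j] c[of k] by (auto split: if_splits)
qed

lemma wavelet_set_emeasure:
  assumes "wavelet_set p M N \<Omega>"
  shows "emeasure N \<Omega> = 1"
proof -
  have "dil_pow 0 ` \<Omega> = \<Omega>" by (simp add: dil_pow_0)
  then have "measure N \<Omega> = 1" using wavelet_set_orthogonality[OF assms, of 0 0] by simp
  then show ?thesis
    using wavelet_set_finite[OF assms] by (simp add: emeasure_eq_ennreal_measure less_top)
qed

lemma wavelet_set_dil_pow_null:
  assumes "wavelet_set p M N \<Omega>" "k \<noteq> 0"
  shows "\<Omega> \<inter> dil_pow k ` \<Omega> \<in> null_sets N"
proof -
  have \<Omega>: "\<Omega> \<in> sets N" using assms by (simp add: wavelet_set_def)
  have "dil_pow 0 ` \<Omega> = \<Omega>" by (simp add: dil_pow_0)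
  then have "measure N (\<Omega> \<inter> dil_pow k ` \<Omega>) = 0"
    using wavelet_set_orthogonality[OF assms(1), of 0 k] assms(2) by simp
  moreover have "emeasure N (\<Omega> \<inter> dil_pow k ` \<Omega>) \<noteq> \<infinity>"
    using emeasure_mono[of "\<Omega> \<inter> dil_pow k ` \<Omega>" \<Omega> N] wavelet_set_emeasure[OF assms(1)] \<Omega>
    by (auto simp: top_unique)
  ultimately show ?thesis using \<Omega> by (auto simp: null_sets_def emeasure_eq_ennreal_measure)
qed

end

section \<open>Assembly of the two implications\<close>

theorem lemma4p5:
  fixes p :: nat and M N :: "vseq measure" and S :: "vseq set"
  assumes "prime p"
    and "normalized_haar p M"
    and "normalized_haar p N"
    and "S \<in> sets N"
  shows "generalized_scaling_set p M N S \<longleftrightarrow>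
    (\<exists>\<Omega>. wavelet_set p M N \<Omega> \<and>
       sym_diff S (\<Union>j\<in>{1::nat..}. dil_pow (- int j) ` \<Omega>) \<in> null_sets N)"
proof -
  interpret haar_pair p M N
    using assms prime_ge_2_nat by unfold_locales auto
  have sets: "dil ` S - S \<in> sets N" using assms(4) N.dil_pow_sets[of S 1] by (auto simp: dil_pow_1)
  show ?thesis
    unfolding UN_atLeast_1
  proof
    assume "generalized_scaling_set p M N S"
    then have S: "emeasure N S = ennreal (1 / (real p - 1))" and \<Omega>: "wavelet_set p M N (dil ` S - S)"
      by (auto simp: generalized_scaling_set_def)
    show "\<exists>\<Omega>. wavelet_set p M N \<Omega> \<and> sym_diff S (\<Union>i. dil_pow (- int (Suc i)) ` \<Omega>) \<in> null_sets N"
      using \<Omega> N.sym_diff_dil_pow_Union_null[OF assms(4) S] wavelet_set_emeasure[OF \<Omega>]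
      by (auto simp only: dil_pow_1)
  next
    assume "\<exists>\<Omega>. wavelet_set p M N \<Omega> \<and> sym_diff S (\<Union>i. dil_pow (- int (Suc i)) ` \<Omega>) \<in> null_sets N"
    then obtain \<Omega> where \<Omega>: "wavelet_set p M N \<Omega>"
      and S: "sym_diff S (\<Union>i. dil_pow (- int (Suc i)) ` \<Omega>) \<in> null_sets N" by blast
    have "\<Omega> \<in> sets N" using \<Omega> by (simp add: wavelet_set_def)
    \<comment> \<open>The tiling gives the measure of \<open>S\<close> and shows that B S - S equals
      \<Omega> up to a null set; the wavelet property then passes from \<Omega> to B S - S by
      \<open>wavelet_set_cong\<close>.\<close>
    note tiling = N.dil_pow_tiling[OF this wavelet_set_emeasure[OF \<Omega>] wavelet_set_dil_pow_null[OF \<Omega>] assms(4) S]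
    show "generalized_scaling_set p M N S"
      using wavelet_set_cong[OF \<Omega> sets] tiling assms(4)
      by (simp add: generalized_scaling_set_def dil_pow_1)
  qed
qed

end
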